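(* Let $d \geq 2$ and let $\mathcal{P} \subset \mathbb{R}^{d-1}$ be a reflexive polytope of dimension $d-1$. Then: (a) $\mathcal{P}$ and $\mathcal{P}^\vee$ are unimodularly equivalent if and only if $\Gamma(\mathcal{P})$ and $\Gamma(\mathcal{P})^\vee$ are unimodularly equivalent; (b) $\delta(\mathcal{P}) = \delta(\mathcal{P}^\vee)$ if and only if $\delta(\Gamma(\mathcal{P})) = \delta(\Gamma(\mathcal{P})^\vee)$.
   Context: An integral convex polytope is a convex polytope whose vertices have integer coordinates. For a polytope $\mathcal{P}\subset\mathbb{R}^m$ containing the origin in its interior, its dual is $\mathcal{P}^\vee = \{y \in \mathbb{R}^m : \langle x,y\rangle \le 1 \text{ for all } x \in \mathcal{P}\}$. An integral convex polytope $\mathcal{P} \subset \mathbb{R}^m$ of dimension $m$ is reflexive if the origin is the unique integer point in the interior of $\mathcal{P}$ and $\mathcal{P}^\vee$ is also an integral polytope. For an integral convex polytope $\mathcal{P} \subset \mathbb{R}^{d-1}$ of dimension $d-1$, define $\Gamma(\mathcal{P}) = \mathrm{conv}\big((\mathcal{P} \times [-1,0]) \cup \{(0,\ldots,0,1)\}\big) \subset \mathbb{R}^d$. Two integral convex polytopes $\mathcal{P}, \mathcal{Q} \subset \mathbb{R}^m$ of dimension $m$ are unimodularly equivalent if there are a matrix $U \in \mathbb{Z}^{m\times m}$ with $\det U = \pm 1$ and a vector $w \in \mathbb{Z}^m$ such that $\mathcal{Q} = f_U(\mathcal{P}) + w$, where $f_U(v) = vU$ (row vectors). For an integral convex polytope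 $\mathcal{P} \subset \mathbb{R}^m$ of dimension $m$, its $\delta$-vector $\delta(\mathcal{P}) = (\delta_0,\ldots,\delta_m)$ is defined by $1 + \sum_{n\ge1} |n\mathcal{P} \cap \mathbb{Z}^m| t^n = \frac{\delta_0 + \delta_1 t + \cdots + \delta_m t^m}{(1-t)^{m+1}}$. *)

theory Defs
  imports "HOL-Analysis.Analysis" "HOL-Computational_Algebra.Computational_Algebra"
begin

definition integer_points :: "(real^'n) set" where
  "integer_points = {x. \<forall>i. x $ i \<in> \<int>}"

definition integral_polytope :: "(real^'n) set \<Rightarrow> bool" where
  "integral_polytope P \<longleftrightarrow>
     polytope P \<and> (\<forall>v. v extreme_point_of P \<longrightarrow> v \<in> integer_points)"

definition dual_polytope :: "(real^'n) set \<Rightarrow> (real^'n) set" where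
  "dual_polytope P = {y. \<forall>x\<in>P. x \<bullet> y \<le> 1}"

definition reflexive_polytope :: "(real^'n) set \<Rightarrow> bool" where
  "reflexive_polytope P \<longleftrightarrow>
     integral_polytope P \<and> aff_dim P = int CARD('n) \<and>
     interior P \<inter> integer_points = {0} \<and>
     integral_polytope (dual_polytope P)"

text \<open>If \<open>real^'n\<close> is the space of dimension \<open>d - 1\<close>, that is \<open>d = CARD('n) + 1\<close>
  (so \<open>d \<ge> 2\<close>, as every type is inhabited), then \<open>real^('n option)\<close> is the space of
  dimension \<open>d\<close>: the index \<open>None\<close> stands for the last coordinate.\<close>

definition append_coord :: "real^'n \<Rightarrow> real \<Rightarrow> real^('n option)" where
  "append_coord x t = (\<chi> i. case i of None \<Rightarrow> t | Some j \<Rightarrow> x $ j)"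

definition Gamma_polytope :: "(real^'n) set \<Rightarrow> (real^('n option)) set" where
  "Gamma_polytope P =
     convex hull ({append_coord x t |x t. x \<in> P \<and> t \<in> {-1..0}} \<union> {append_coord 0 1})"

definition unimodularly_equivalent :: "(real^'n) set \<Rightarrow> (real^'n) set \<Rightarrow> bool" where
  "unimodularly_equivalent P Q \<longleftrightarrow>
     (\<exists>(U::real^'n^'n) w. (\<forall>i j. U $ i $ j \<in> \<int>) \<and> (det U = 1 \<or> det U = -1) \<and>
        w \<in> integer_points \<and> Q = (\<lambda>v. v v* U + w) ` P)"

definition Ehrhart_series :: "(real^'n) set \<Rightarrow> real fps" where
  "Ehrhart_series P = Abs_fps (\<lambda>n. if n = 0 then 1
     else of_nat (card (((\<lambda>x. real n *\<^sub>R x) ` P) \<inter> integer_points)))"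

text \<open>The \<open>\<delta>\<close>-vector is represented by the list of its entries. Uniqueness is
  \<open>delta_vector_unique\<close> below; existence for integral polytopes of full dimension
  is a classical consequence of the theory of Ehrhart polynomials.\<close>

definition is_delta_vector :: "(real^'n) set \<Rightarrow> real list \<Rightarrow> bool" where
  "is_delta_vector P \<delta> \<longleftrightarrow>
     length \<delta> = CARD('n) + 1 \<and>
     Ehrhart_series P =
       (\<Sum>i\<le>CARD('n). fps_const (\<delta> ! i) * fps_X ^ i) / (1 - fps_X) ^ (CARD('n) + 1)"

definition delta_vector :: "(real^'n) set \<Rightarrow> real list" where
  "delta_vector P = (THE \<delta>. is_delta_vector P \<delta>)"

lemma delta_vector_unique:
  fixes P :: "(real^'n) set"
  assumes "is_delta_vector P \<delta>" "is_delta_vector P \<epsilon>"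
  shows "\<delta> = \<epsilon>"
proof -
  let ?N = "\<lambda>\<delta>. \<Sum>i\<le>CARD('n). fps_const (\<delta> ! i) * fps_X ^ i :: real fps"
  let ?D = "(1 - fps_X) ^ (CARD('n) + 1) :: real fps"
  have D: "fps_nth ?D 0 \<noteq> 0"
    by (simp add: fps_nth_power_0)
  have N: "?N x = Ehrhart_series P * ?D" if "is_delta_vector P x" for x
  proof -
    have "Ehrhart_series P = ?N x * inverse ?D"
      using that fps_divide_unit[OF D, of "?N x"] unfolding is_delta_vector_def by argo
    then show ?thesis
      using inverse_mult_eq_1[OF D] by (simp only: mult.assoc mult_1_right)
  qed
  have nth: "fps_nth (?N x) k = x ! k" if "k \<le> CARD('n)" for x :: "real list" and k
    using that by (simp add: fps_sum_nth fps_X_power_nth if_distrib[of "\<lambda>z. _ * z"] sum.delta cong: if_cong)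
  show ?thesis
  proof (rule nth_equalityI)
    show "length \<delta> = length \<epsilon>"
      using assms by (simp add: is_delta_vector_def)
    fix k assume "k < length \<delta>"
    then have "k \<le> CARD('n)"
      using assms by (simp add: is_delta_vector_def)
    then show "\<delta> ! k = \<epsilon> ! k"
      using nth[of k \<delta>] nth[of k \<epsilon>] N[OF assms(1)] N[OF assms(2)] by simp
  qed
qed

end

theory Submission
  imports Defs
begin

text \<open>
  \<open>\<Gamma>(P)\<close> consists of the points \<open>(x, t)\<close> with \<open>-1 \<le> t \<le> 1\<close> and \<open>x \<in> (1 - max t 0) P\<close>, so its dual is
  the reflection of \<open>\<Gamma>(P\<^sup>\<or>)\<close> in the last coordinate.

  (a) An equivalence \<open>P\<^sup>\<or> = P U\<close> extends to the block matrix with blocks \<open>U\<close> and \<open>-1\<close>. Conversely, the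
  base of \<open>\<Gamma>(P)\<close> is its only facet with an integer point in its relative interior, so a unimodular
  map from \<open>\<Gamma>(P)\<close> to \<open>\<Gamma>(P\<^sup>\<or>)\<close> preserves that point and the functional \<open>t\<close> and restricts to an
  equivalence of the slices \<open>t = 0\<close>. Translations do not occur, since the origin is the only interior
  integer point of all polytopes involved.

  (b) Slicing \<open>n \<Gamma>(P)\<close> at integer heights gives \<open>L'(n) = (n + 1) L(n) + (L(0) + \<dots> + L(n - 1))\<close> for the
  counting functions \<open>L\<close> of \<open>P\<close> and \<open>L'\<close> of \<open>\<Gamma>(P)\<close>, and this determines \<open>L\<close> from \<open>L'\<close>. To pass from
  Ehrhart series to \<open>\<delta>\<close>-vectors one needs Ehrhart's theorem. For this, the cone over the polytope is
  cut into half-open simplicial cones: their bases are the optimal ones of a linear program with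
  generic costs \<open>c\<close>, and a generic direction \<open>q\<close> decides to which of them a boundary point belongs.
\<close>

subsection \<open>Integer points and generic weights\<close>

text \<open>Induction on \<open>G\<close>: the weights found so far are raised at one
  \<open>u\<close> with \<open>g u \<noteq> 0\<close>. Each sum is affine in the increment, so it
  vanishes for at most one value or does not depend on the increment.\<close>

lemma generic_positive_weights:
  fixes G :: "('a \<Rightarrow> real) set"
  assumes "finite V" "finite G" "\<And>g. g \<in> G \<Longrightarrow> \<exists>v\<in>V. g v \<noteq> 0"
  shows "\<exists>c. (\<forall>v\<in>V. 0 < c v) \<and> (\<forall>g\<in>G. (\<Sum>v\<in>V. g v * c v) \<noteq> 0)"
  using assms(2,3)
proof (induction G)
  case empty
  show ?case by (rule exI[of _ "\<lambda>_. 1"]) simp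
next
  case (insert g G)
  then obtain c where c: "\<forall>v\<in>V. 0 < c v" "\<forall>g\<in>G. (\<Sum>v\<in>V. g v * c v) \<noteq> 0"
    by auto
  obtain u where u: "u \<in> V" "g u \<noteq> 0"
    using insert.prems by auto
  \<comment> \<open>These are the only increments at which a sum depending on the increment can
    vanish. For \<open>h u = 0\<close> the entry is 0 by division by 0; the sum for such
    \<open>h\<close> does not change.\<close>
  define bad where "bad = (\<lambda>h. - (\<Sum>v\<in>V. h v * c v) / h u) ` insert g G"
  have "finite bad"
    using insert.hyps by (simp add: bad_def)
  then have "infinite ({0<..<1} - bad)"
    by (simp add: Diff_infinite_finite)
  then obtain t where t: "0 < t" "t \<notin> bad"
    by (metis Diff_iff finite.emptyI greaterThanLessThan_iff subsetI finite_subset)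
  let ?c = "\<lambda>v. c v + (if v = u then t else 0)"
  have eq: "(\<Sum>v\<in>V. h v * ?c v) = (\<Sum>v\<in>V. h v * c v) + h u * t" for h
    using u(1) assms(1) by (simp add: distrib_left sum.distrib if_distrib[of "\<lambda>z. _ * z"] sum.delta cong: if_cong)
  have "(\<Sum>v\<in>V. h v * ?c v) \<noteq> 0" if "h \<in> insert g G" for h
  proof (cases "h u = 0")
    case True
    then show ?thesis using that c(2) u(2) unfolding eq by auto
  next
    case False
    then have "t \<noteq> - (\<Sum>v\<in>V. h v * c v) / h u"
      using t(2) that by (auto simp: bad_def)
    then show ?thesis using False unfolding eq by (simp add: field_simps) 
  qed
  moreover have "\<forall>v\<in>V. 0 < ?c v"
    using c(1) t(1) by (auto intro: add_pos_pos)
  ultimately show ?case by (intro exI[of _ ?c]) simp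
qed

text \<open>For small positive \<open>e\<close> the term \<open>e * b\<close> decides the sign only
  if \<open>a = 0\<close>. This is how a generic perturbation chooses between weak and strict
  inequalities.\<close>

lemma perturbed_sign:
  fixes a b :: real
  assumes "b \<noteq> 0"
  shows "\<forall>\<^sub>F e in at_right 0. a + e * b \<noteq> 0 \<and>
    (0 < a + e * b \<longleftrightarrow> (if 0 < b then 0 \<le> a else 0 < a))"
proof (cases "a = 0")
  case True
  have "\<forall>\<^sub>F e in at_right 0. 0 < (e::real)"
    by (simp add: eventually_at_right_less)
  then show ?thesis
    by eventually_elim (use True assms in \<open>auto simp: zero_less_mult_iff\<close>)
next
  case False
  have "((\<lambda>e. a + e * b) \<longlongrightarrow> a + 0 * b) (at_right 0)"
    by (intro tendsto_intros)
  then have "\<forall>\<^sub>F e in at_right 0. dist (a + e * b) a < \<bar>a\<bar>"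
    using False by (simp add: tendsto_iff)
  then show ?thesis
    by eventually_elim (use False in \<open>auto simp: dist_real_def abs_if split: if_splits\<close>)
qed

lemma finite_integer_points_cube:
  "finite {x :: real^'n. x \<in> integer_points \<and> (\<forall>i. \<bar>x $ i\<bar> \<le> r)}"
proof -
  let ?S = "{k :: real. k \<in> \<int> \<and> \<bar>k\<bar> \<le> r}"
  have "{x :: real^'n. x \<in> integer_points \<and> (\<forall>i. \<bar>x $ i\<bar> \<le> r)} \<subseteq>
      vec_lambda ` (UNIV \<rightarrow>\<^sub>E ?S)"
  proof
    fix x :: "real^'n"
    assume "x \<in> {x. x \<in> integer_points \<and> (\<forall>i. \<bar>x $ i\<bar> \<le> r)}"
    then have "vec_nth x \<in> UNIV \<rightarrow>\<^sub>E ?S"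
      by (auto simp: integer_points_def)
    then show "x \<in> vec_lambda ` (UNIV \<rightarrow>\<^sub>E ?S)"
      by (intro image_eqI[of _ _ "vec_nth x"]) simp_all
  qed
  moreover have "finite ?S"
    by (rule finite_abs_int_segment)
  ultimately show ?thesis
    by (elim finite_subset) (intro finite_imageI finite_PiE, auto)
qed

lemma finite_bounded_integer_points:
  fixes S :: "(real^'n) set"
  assumes "bounded S"
  shows "finite (S \<inter> integer_points)"
proof -
  obtain r where "\<And>x. x \<in> S \<Longrightarrow> norm x \<le> r"
    using assms bounded_iff by blast
  then have "S \<inter> integer_points \<subseteq> {x. x \<in> integer_points \<and> (\<forall>i. \<bar>x $ i\<bar> \<le> r)}"
    using component_le_norm_cart order_trans by fastforce
  then show ?thesis
    using finite_integer_points_cube finite_subset by blast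
qed

lemma integer_points_add: "x \<in> integer_points \<Longrightarrow> y \<in> integer_points \<Longrightarrow> x + y \<in> integer_points"
  and integer_points_diff: "x \<in> integer_points \<Longrightarrow> y \<in> integer_points \<Longrightarrow> x - y \<in> integer_points"
  by (auto simp: integer_points_def)

subsection \<open>Half-open decomposition of a cone\<close>

text \<open>The cone over a polytope whose generators sit at height 1 in coordinate
  \<open>h\<close>. Heights act as degrees: for \<open>n > 0\<close> the slice at height
  \<open>n\<close> is the \<open>n\<close>-th dilate.\<close>

locale integral_cone =
  fixes V :: "(real^'n) set" and h :: 'n
  assumes finite_V: "finite V"
    and integral_V: "V \<subseteq> integer_points"
    and height_V: "v \<in> V \<Longrightarrow> v $ h = 1"
    and span_V: "span V = UNIV"
begin

definition bases :: "(real^'n) set set" where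
  "bases = {B. B \<subseteq> V \<and> independent B \<and> span B = UNIV}"

definition cone_V :: "(real^'n) set" where
  "cone_V = {\<Sum>v\<in>V. a v *\<^sub>R v | a. \<forall>v\<in>V. 0 \<le> a v}"

lemma finite_bases: "finite bases"
  unfolding bases_def using finite_V by simp

lemma
  assumes "B \<in> bases"
  shows basis_subset: "B \<subseteq> V" and basis_independent: "independent B"
    and basis_span: "span B = UNIV" and finite_basis: "finite B"
    and card_basis: "card B = CARD('n)"
proof -
  show B: "B \<subseteq> V" "independent B" "span B = UNIV"
    using assms by (auto simp: bases_def)
  then show "finite B"
    using finite_V finite_subset by blast
  show "card B = CARD('n)"
    using B basis_card_eq_dim[of B UNIV] by simp
qed

lemma basisI:
  assumes "B \<subseteq> V" "independent B" "card B = CARD('n)"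
  shows "B \<in> bases"
  using assms card_ge_dim_independent[of B UNIV] by (auto simp: bases_def)

lemma
  assumes "B \<in> bases"
  shows coord_add: "representation B (x + y) u = representation B x u + representation B y u"
    and coord_scale: "representation B (r *\<^sub>R x) u = r * representation B x u"
    and coord_sum: "representation B (\<Sum>i\<in>I. f i) u = (\<Sum>i\<in>I. representation B (f i) u)"
    and coord_basis: "w \<in> B \<Longrightarrow> representation B w u = (if u = w then 1 else 0)"
  using basis_independent[OF assms] basis_span[OF assms]
  by (simp_all add: representation_add representation_scale
      representation_sum representation_basis)

lemma coord_outside: "u \<notin> B \<Longrightarrow> representation B x u = 0"
  using representation_ne_zero by blast

lemma sum_coord:
  assumes "B \<in> bases"
  shows "(\<Sum>u\<in>B. representation B x u *\<^sub>R u) = x"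
  using sum_representation_eq[OF basis_independent[OF assms] _ finite_basis[OF assms]]
    basis_span[OF assms] by simp

lemma coord_eqI:
  assumes "B \<in> bases" "x = (\<Sum>u\<in>B. a u *\<^sub>R u)" "u \<in> B"
  shows "representation B x u = a u"
proof -
  have "representation B x u = (\<Sum>w\<in>B. a w * (if u = w then 1 else 0))"
    unfolding assms(2) coord_sum[OF assms(1)] coord_scale[OF assms(1)]
    using coord_basis[OF assms(1)] by (intro sum.cong) auto
  then show ?thesis
    using assms(3) finite_basis[OF assms(1)] by (simp add: if_distrib cong: if_cong)
qed

lemma height_eq_sum:
  assumes "S \<subseteq> V"
  shows "(\<Sum>u\<in>S. a u *\<^sub>R u) $ h = (\<Sum>u\<in>S. a u)"
proof -
  have "(\<Sum>u\<in>S. a u *\<^sub>R u) $ h = (\<Sum>u\<in>S. a u * u $ h)"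
    by simp
  also have "\<dots> = (\<Sum>u\<in>S. a u)"
    using assms height_V by (intro sum.cong) auto
  finally show ?thesis .
qed

lemma height_coord: "B \<in> bases \<Longrightarrow> (\<Sum>u\<in>B. representation B x u) = x $ h"
  using height_eq_sum[of B "representation B x"] by (simp add: basis_subset sum_coord)

lemma coneI:
  assumes "S \<subseteq> V" "\<And>v. v \<in> S \<Longrightarrow> 0 \<le> a v"
  shows "(\<Sum>v\<in>S. a v *\<^sub>R v) \<in> cone_V"
proof -
  have "(\<Sum>v\<in>S. a v *\<^sub>R v) = (\<Sum>v\<in>V. (if v \<in> S then a v else 0) *\<^sub>R v)"
    using assms(1) finite_V by (intro sum.mono_neutral_cong_left) auto
  then show ?thesis
    unfolding cone_V_def using assms(2) by (auto intro!: exI[of _ "\<lambda>v. if v \<in> S then a v else 0"])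
qed

lemma coord_nonneg_imp_cone:
  assumes "B \<in> bases" "\<And>u. u \<in> B \<Longrightarrow> 0 \<le> representation B x u"
  shows "x \<in> cone_V"
  using coneI[of B "representation B x"] assms by (simp add: basis_subset sum_coord)

lemma cone_add:
  assumes "x \<in> cone_V" "y \<in> cone_V"
  shows "x + y \<in> cone_V"
proof -
  obtain a b where "\<forall>v\<in>V. 0 \<le> a v" "x = (\<Sum>v\<in>V. a v *\<^sub>R v)" 
    "\<forall>v\<in>V. 0 \<le> b v" "y = (\<Sum>v\<in>V. b v *\<^sub>R v)"
    using assms by (auto simp: cone_V_def)
  then have "x + y = (\<Sum>v\<in>V. (a v + b v) *\<^sub>R v)" "\<forall>v\<in>V. 0 \<le> a v + b v"
    by (auto simp: scaleR_add_left sum.distrib)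
  then show ?thesis
    using coneI[of V "\<lambda>v. a v + b v"] by simp
qed

lemma cone_scale:
  assumes "x \<in> cone_V" "0 \<le> r"
  shows "r *\<^sub>R x \<in> cone_V"
proof -
  obtain a where a: "\<forall>v\<in>V. 0 \<le> a v" "x = (\<Sum>v\<in>V. a v *\<^sub>R v)"
    using assms by (auto simp: cone_V_def)
  then have "r *\<^sub>R x = (\<Sum>v\<in>V. (r * a v) *\<^sub>R v)"
    by (simp add: scaleR_sum_right)
  then show ?thesis
    using coneI[of V "\<lambda>v. r * a v"] a(1) assms(2) by simp
qed

lemma cone_height_nonneg: "x \<in> cone_V \<Longrightarrow> 0 \<le> x $ h"
  unfolding cone_V_def using height_eq_sum[OF order_refl] by (auto intro!: sum_nonneg simp del: sum_component)

text \<open>The coefficients of a conic combination sum to its height, so division by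
  \<open>r\<close> makes it convex.\<close>

lemma cone_eq_convex_hull:
  assumes "0 < r"
  shows "x \<in> cone_V \<and> x $ h = r \<longleftrightarrow> x \<in> (\<lambda>y. r *\<^sub>R y) ` (convex hull V)"
proof
  assume x: "x \<in> cone_V \<and> x $ h = r"
  then obtain a where a: "\<forall>v\<in>V. 0 \<le> a v" "x = (\<Sum>v\<in>V. a v *\<^sub>R v)"
    by (auto simp: cone_V_def)
  then have "sum a V = r"
    using x height_eq_sum[OF order_refl, of a] by simp
  then have "(\<Sum>v\<in>V. (a v / r) *\<^sub>R v) \<in> convex hull V"
    using a(1) assms by (auto simp: convex_hull_finite[OF finite_V] sum_divide_distrib[symmetric]
        intro!: exI[of _ "\<lambda>v. a v / r"])
  moreover have "x = r *\<^sub>R (\<Sum>v\<in>V. (a v / r) *\<^sub>R v)"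
    using assms a(2) by (simp add: scaleR_sum_right)
  ultimately show "x \<in> (\<lambda>y. r *\<^sub>R y) ` (convex hull V)"
    by blast
next
  assume "x \<in> (\<lambda>y. r *\<^sub>R y) ` (convex hull V)"
  then obtain a where a: "\<forall>v\<in>V. 0 \<le> a v" "sum a V = 1" "x = r *\<^sub>R (\<Sum>v\<in>V. a v *\<^sub>R v)"
    by (auto simp: convex_hull_finite[OF finite_V])
  then show "x \<in> cone_V \<and> x $ h = r"
    using cone_scale[OF coneI[of V a], of r] height_eq_sum[of V a] assms by simp
qed

lemma cone_height_zero:
  assumes "x \<in> cone_V" "x $ h = 0"
  shows "x = 0"
proof -
  obtain a where a: "\<forall>v\<in>V. 0 \<le> a v" "x = (\<Sum>v\<in>V. a v *\<^sub>R v)"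
    using assms by (auto simp: cone_V_def)
  then have "sum a V = 0"
    using assms(2) height_eq_sum[OF order_refl, of a] by simp
  then have "\<forall>v\<in>V. a v = 0"
    using a(1) sum_nonneg_eq_0_iff[OF finite_V] by blast
  then show ?thesis
    using a(2) by simp
qed

lemma finite_slice: "finite (cone_V \<inter> {x. x $ h = r} \<inter> integer_points)"
proof (cases "0 < r")
  case True
  then have "cone_V \<inter> {x. x $ h = r} = (\<lambda>y. r *\<^sub>R y) ` (convex hull V)"
    using cone_eq_convex_hull by blast
  moreover have "bounded ((\<lambda>y. r *\<^sub>R y) ` (convex hull V))"
    using finite_V by (intro bounded_scaling) (simp add: bounded_convex_hull finite_imp_bounded)
  ultimately show ?thesis
    using finite_bounded_integer_points by metis
next
  case False
  then have "cone_V \<inter> {x. x $ h = r} \<subseteq> {0}"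
    using cone_height_nonneg cone_height_zero by force
  then show ?thesis
    by (meson finite.emptyI finite.insertI finite_Int finite_subset)
qed

text \<open>Caratheodory's theorem for cones: a smallest subset of \<open>V\<close> whose hull
  contains the normalized point is independent, and extending it to a basis only enlarges the
  hull.\<close>

lemma cone_basis_exists:
  assumes "z \<in> cone_V" "0 < z $ h"
  shows "\<exists>B\<in>bases. \<forall>u\<in>B. 0 \<le> representation B z u"
proof -
  define y where "y = (1 / z $ h) *\<^sub>R z"
  have "z \<in> (\<lambda>y. (z $ h) *\<^sub>R y) ` (convex hull V)"
    using cone_eq_convex_hull[OF assms(2)] assms(1) by blast
  then obtain w where w: "z = (z $ h) *\<^sub>R w" "w \<in> convex hull V"
    by blast
  have "y = (1 / z $ h) *\<^sub>R (z $ h) *\<^sub>R w"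
    unfolding y_def using w(1) by simp
  then have y: "y \<in> convex hull V"
    using assms(2) w(2) by simp
  define P where "P = (\<lambda>S. S \<subseteq> V \<and> y \<in> convex hull S)"
  have "P V" using y by (simp add: P_def)
  then obtain S where S: "P S" "\<And>T. P T \<Longrightarrow> card S \<le> card T"
    using arg_min_nat_lemma[of P V card] by metis
  have fS: "finite S" "S \<subseteq> V" "y \<in> convex hull S"
    using S(1) finite_V finite_subset by (auto simp: P_def)
  obtain T where T: "finite T" "T \<subseteq> S" "card T \<le> aff_dim S + 1" "y \<in> convex hull T"
    using fS(3) unfolding caratheodory_aff_dim[of S] by blast
  have "card S \<le> card T"
    using S(2)[of T] T fS by (auto simp: P_def)
  then have "\<not> affine_dependent S"
    using T(3) fS(1) aff_dim_le_card[of S] by (simp add: affine_independent_iff_card)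
  \<comment> \<open>At height 1 the coefficients of a linear relation sum to 0, so it is an affine
    relation.\<close>
  have "independent S"
  proof
    assume "dependent S"
    then obtain a where a: "\<exists>v\<in>S. a v \<noteq> 0" "(\<Sum>v\<in>S. a v *\<^sub>R v) = 0"
      using dependent_finite[OF fS(1)] by auto
    then have "sum a S = 0"
      using height_eq_sum[OF fS(2), of a] by simp
    then show False
      using \<open>\<not> affine_dependent S\<close> a affine_dependent_explicit_finite[OF fS(1)] by blast
  qed
  then obtain B where B: "S \<subseteq> B" "B \<subseteq> V" "independent B" "V \<subseteq> span B"
    using maximal_independent_subset_extend[OF fS(2)] by blast
  then have BB: "B \<in> bases"
    unfolding bases_def using span_V by (metis (mono_tags) mem_Collect_eq span_mono span_span top.extremum_uniqueI)
  have "y \<in> convex hull B"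
    using fS(3) B(1) hull_mono by blast
  then obtain a where a: "\<forall>u\<in>B. 0 \<le> a u" "y = (\<Sum>u\<in>B. a u *\<^sub>R u)"
    using convex_hull_finite[OF finite_basis[OF BB]] by auto
  have "z = (z $ h) *\<^sub>R y"
    using assms(2) by (simp add: y_def)
  then have "representation B z u = (z $ h) * a u" if "u \<in> B" for u
    using coord_scale[OF BB] coord_eqI[OF BB a(2) that] by metis
  then show ?thesis
    using BB a(1) assms(2) by (intro bexI[OF _ BB]) simp
qed

end

section \<open>Optimal bases of a generic linear program and their half-open cones\<close>

context integral_cone
begin

text \<open>The linear functional that agrees with \<open>c\<close> on \<open>B\<close>: the dual
  solution of the linear program that belongs to this basis.\<close>

definition cost :: "(real^'n \<Rightarrow> real) \<Rightarrow> (real^'n) set \<Rightarrow> real^'n \<Rightarrow> real" where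
  "cost c B x = (\<Sum>u\<in>B. representation B x u * c u)"

text \<open>All reduced costs are positive. For generic \<open>c\<close> the cones over these bases
  are the maximal cones of the regular triangulation obtained by lifting each \<open>v\<close> to
  \<open>c v\<close>.\<close>

definition optimal_bases :: "(real^'n \<Rightarrow> real) \<Rightarrow> (real^'n) set set" where
  "optimal_bases c = {B \<in> bases. \<forall>v\<in>V - B. cost c B v < c v}"

lemma cost_sum:
  assumes "B \<in> bases"
  shows "cost c B (\<Sum>w\<in>S. a w *\<^sub>R w) = (\<Sum>w\<in>S. a w * cost c B w)"
  unfolding cost_def coord_sum[OF assms] coord_scale[OF assms]
  by (simp add: sum_distrib_left sum_distrib_right mult.assoc) (rule sum.swap)

lemma cost_basis:
  assumes "B \<in> bases" "w \<in> B"
  shows "cost c B w = c w"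
proof -
  have "cost c B w = (\<Sum>u\<in>B. (if u = w then 1 else 0) * c u)"
    unfolding cost_def using assms coord_basis by simp
  then show ?thesis
    using assms finite_basis by (simp add: if_distrib[of "\<lambda>z. z * _"] cong: if_cong)
qed

text \<open>On \<open>V\<close> the functional of an optimal basis is at most \<open>c\<close>, and
  less than \<open>c\<close> off \<open>B\<close>. Expanding \<open>z\<close> in \<open>B'\<close>
  with positive coefficients compares the costs.\<close>

lemma optimal_cost_less:
  assumes "B \<in> optimal_bases c" "B' \<in> bases" "\<And>u. u \<in> B' \<Longrightarrow> 0 < representation B' z u" "\<not> B' \<subseteq> B"
  shows "cost c B z < cost c B' z"
proof -
  have B: "B \<in> bases" using assms(1) by (simp add: optimal_bases_def)
  have le: "cost c B u \<le> c u" if "u \<in> B'" for u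
    using that assms(1) cost_basis[OF B, of u c] basis_subset[OF assms(2)]
    unfolding optimal_bases_def by force
  obtain w where w: "w \<in> B'" "w \<notin> B" using assms(4) by blast
  then have less: "cost c B w < c w"
    using assms(1) basis_subset[OF assms(2)] by (auto simp: optimal_bases_def)
  have "cost c B z = (\<Sum>u\<in>B'. representation B' z u * cost c B u)"
    using cost_sum[OF B, of c "representation B' z" B'] sum_coord[OF assms(2), of z] by simp
  also have "\<dots> < (\<Sum>u\<in>B'. representation B' z u * c u)"
    using finite_basis[OF assms(2)] w(1) less le assms(3)
    by (intro sum_strict_mono_ex1) (auto intro!: bexI[of _ w] mult_left_mono simp: less_imp_le)
  finally show ?thesis
    by (simp add: cost_def)
qed

text \<open>Bases have equal cardinality, so of two different ones neither contains the other, and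
  each would be strictly cheaper than the other at \<open>z\<close>.\<close>

lemma optimal_basis_unique:
  assumes "B \<in> optimal_bases c" "B' \<in> optimal_bases c"
    and "\<And>u. u \<in> B \<Longrightarrow> 0 < representation B z u" "\<And>u. u \<in> B' \<Longrightarrow> 0 < representation B' z u"
  shows "B = B'"
proof (rule ccontr)
  assume "B \<noteq> B'"
  have bases: "B \<in> bases" "B' \<in> bases"
    using assms(1,2) by (auto simp: optimal_bases_def)
  then have "\<not> B \<subseteq> B'" "\<not> B' \<subseteq> B"
    using \<open>B \<noteq> B'\<close> card_basis finite_basis card_subset_eq by metis+
  then show False
    using optimal_cost_less[OF assms(1) bases(2) assms(4)]
      optimal_cost_less[OF assms(2) bases(1) assms(3)] by force
qed

text \<open>The simplex step: a violating \<open>v\<close> enters the basis and lowers the cost.\<close>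

lemma pivot:
  assumes B: "B \<in> bases" "\<And>u. u \<in> B \<Longrightarrow> 0 < representation B z u"
    and v: "v \<in> V - B" "c v < cost c B v"
    and generic: "\<And>B u. B \<in> bases \<Longrightarrow> u \<in> B \<Longrightarrow> representation B z u \<noteq> 0"
  shows "\<exists>B'\<in>bases. (\<forall>u\<in>B'. 0 < representation B' z u) \<and> cost c B' z < cost c B z"
proof -
  let ?l = "representation B z" and ?a = "representation B v"
  have fB: "finite B" by (rule finite_basis[OF B(1)])
  \<comment> \<open>The coordinates of \<open>v\<close> sum to its height 1, so one of them is
    positive and some vector can leave the basis.\<close>
  have "(\<Sum>u\<in>B. ?a u) = 1"
    using height_coord[OF B(1), of v] v(1) height_V by simp
  then have ne: "{u\<in>B. 0 < ?a u} \<noteq> {}"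
    using sum_nonpos[of B ?a] by (force simp: not_less)
  \<comment> \<open>Ratio test: \<open>s\<close> is the largest coefficient that \<open>v\<close>
    can take while the others stay nonnegative; a vector \<open>w\<close> attaining the minimum
    leaves.\<close>
  define s where "s = Min ((\<lambda>u. ?l u / ?a u) ` {u\<in>B. 0 < ?a u})"
  have "s \<in> (\<lambda>u. ?l u / ?a u) ` {u\<in>B. 0 < ?a u}"
    unfolding s_def using ne fB by (intro Min_in) auto
  then obtain w where w: "w \<in> B" "0 < ?a w" "s = ?l w / ?a w" by auto
  have s: "0 < s" using w B(2) by simp
  have nonneg: "0 \<le> ?l u - s * ?a u" if "u \<in> B" for u
  proof (cases "0 < ?a u")
    case True
    then have "s \<le> ?l u / ?a u"
      unfolding s_def using that fB by (intro Min_le) auto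
    then show ?thesis using True by (simp add: field_simps)
  next
    case False
    then have "s * ?a u \<le> 0" using s by (simp add: mult_nonneg_nonpos)
    then show ?thesis using B(2)[OF that] by simp
  qed
  let ?B = "insert v (B - {w})"
  have fB': "finite (B - {w})" "v \<notin> B - {w}" using fB v by auto
  have "v \<notin> span (B - {w})"
  proof
    assume "v \<in> span (B - {w})"
    then have "?a = representation (B - {w}) v"
      using basis_independent[OF B(1)] by (intro representation_extend) auto
    then show False
      using w(2) representation_ne_zero[of "B - {w}" v w] by auto
  qed
  then have "independent ?B"
    using independent_mono[OF basis_independent[OF B(1)], of "B - {w}"]
    by (intro independent_insertI) auto
  moreover have "card ?B = CARD('n)"
    using fB' w(1) card_basis[OF B(1)] fB by (simp add: card_Suc_Diff1)
  ultimately have B': "?B \<in> bases"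
    using v(1) basis_subset[OF B(1)] by (intro basisI) auto
  define b where "b = (\<lambda>u. if u = v then s else ?l u - s * ?a u)"
  have z: "z = (\<Sum>u\<in>?B. b u *\<^sub>R u)"
  proof -
    have "z = s *\<^sub>R v + (\<Sum>u\<in>B. (?l u - s * ?a u) *\<^sub>R u)"
      using sum_coord[OF B(1), of z] sum_coord[OF B(1), of v]
      by (simp add: scaleR_diff_left sum_subtractf scaleR_sum_right[symmetric] flip: scaleR_scaleR)
    also have "(\<Sum>u\<in>B. (?l u - s * ?a u) *\<^sub>R u) = (\<Sum>u\<in>B - {w}. (?l u - s * ?a u) *\<^sub>R u)"
      using w fB by (intro sum.mono_neutral_right) auto
    also have "\<dots> = (\<Sum>u\<in>B - {w}. b u *\<^sub>R u)"
      using fB' by (intro sum.cong) (auto simp: b_def)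
    finally show ?thesis
      using fB' by (simp add: b_def)
  qed
  have coord: "representation ?B z u = b u" if "u \<in> ?B" for u
    by (rule coord_eqI[OF B' z that])
  \<comment> \<open>Nonnegativity comes from the ratio test, strictness from the genericity of
    \<open>z\<close>.\<close>
  have pos: "0 < representation ?B z u" if "u \<in> ?B" for u
  proof -
    have "0 \<le> b u" using that s nonneg by (auto simp: b_def)
    then show ?thesis using generic[OF B' that] coord[OF that] by simp
  qed
  have "cost c ?B z = (\<Sum>u\<in>?B. b u * c u)"
    unfolding cost_def using coord by (intro sum.cong) auto
  also have "\<dots> = s * c v + (\<Sum>u\<in>B - {w}. b u * c u)"
    using fB' by (simp add: b_def)
  also have "(\<Sum>u\<in>B - {w}. b u * c u) = (\<Sum>u\<in>B - {w}. (?l u - s * ?a u) * c u)"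
    using fB' by (intro sum.cong) (auto simp: b_def)
  also have "\<dots> = (\<Sum>u\<in>B. (?l u - s * ?a u) * c u)"
    using w fB by (intro sum.mono_neutral_left) auto
  also have "\<dots> = cost c B z - s * cost c B v"
    by (simp add: cost_def left_diff_distrib sum_subtractf sum_distrib_left mult.assoc)
  finally have "cost c ?B z = cost c B z - s * (cost c B v - c v)"
    by (simp add: algebra_simps)
  moreover have "0 < s * (cost c B v - c v)" using s v(2) by simp
  ultimately show ?thesis
    using B' pos by (intro bexI[of _ ?B]) auto
qed

text \<open>Among the finitely many bases with positive coordinates at \<open>z\<close>, one of
  least cost is optimal, since a violation would permit a pivot to a cheaper one.\<close>

lemma optimal_basis_exists:
  assumes "z \<in> cone_V" "0 < z $ h"
    and generic: "\<And>B u. B \<in> bases \<Longrightarrow> u \<in> B \<Longrightarrow> representation B z u \<noteq> 0"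
    and c: "\<And>B v. B \<in> bases \<Longrightarrow> v \<in> V - B \<Longrightarrow> cost c B v \<noteq> c v"
  shows "\<exists>B\<in>optimal_bases c. \<forall>u\<in>B. 0 < representation B z u"
proof -
  define Q where "Q = {B \<in> bases. \<forall>u\<in>B. 0 < representation B z u}"
  obtain B0 where B0: "B0 \<in> bases" "\<forall>u\<in>B0. 0 \<le> representation B0 z u"
    using cone_basis_exists[OF assms(1,2)] by blast
  then have "B0 \<in> Q"
    using generic unfolding Q_def by (auto simp: less_le dest: not_sym)
  moreover have "finite Q" using finite_bases by (simp add: Q_def)
  ultimately obtain B where B: "B \<in> Q" "\<And>B'. B' \<in> Q \<Longrightarrow> cost c B z \<le> cost c B' z"
    using ex_min_if_finite[of "(\<lambda>B. cost c B z) ` Q"] by (fastforce simp: not_less)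
  have "cost c B v < c v" if v: "v \<in> V - B" for v
  proof (rule ccontr)
    assume "\<not> cost c B v < c v"
    then have "c v < cost c B v" using c[of B v] B(1) v by (auto simp: Q_def)
    then obtain B' where "B' \<in> Q" "cost c B' z < cost c B z"
      using pivot[of B z v c] B(1) v generic by (force simp: Q_def)
    then show False using B(2) by force
  qed
  then show ?thesis
    using B(1) by (auto simp: Q_def optimal_bases_def)
qed

text \<open>The facet on which the coordinate at \<open>u\<close> vanishes is kept if
  \<open>q\<close> lies strictly on its inner side, and removed otherwise.\<close>

definition half_open_cone :: "real^'n \<Rightarrow> (real^'n) set \<Rightarrow> (real^'n) set" where
  "half_open_cone q B = {x. \<forall>u\<in>B. if 0 < representation B q u
     then 0 \<le> representation B x u else 0 < representation B x u}"

text \<open>A point of the cone belongs to the optimal half-open cone into which the direction \<open>q\<close> leads.\<close>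

lemma half_open_decomposition:
  assumes q: "q \<in> cone_V" "0 < q $ h" "\<And>B u. B \<in> bases \<Longrightarrow> u \<in> B \<Longrightarrow> representation B q u \<noteq> 0"
    and c: "\<And>B v. B \<in> bases \<Longrightarrow> v \<in> V - B \<Longrightarrow> cost c B v \<noteq> c v"
    and x: "x \<in> cone_V"
  shows "\<exists>!B. B \<in> optimal_bases c \<and> x \<in> half_open_cone q B"
proof -
  \<comment> \<open>\<open>K B u e\<close> says that the sign of the coordinate at \<open>u\<close>
    after a shift by \<open>e *\<^sub>R q\<close> is the one read off in
    \<open>half_open_cone\<close>. Only finitely many pairs \<open>B\<close>, \<open>u\<close>
    occur, so one small \<open>e\<close> serves them all.\<close>
  define K where "K = (\<lambda>B u e. representation B x u + e * representation B q u \<noteq> 0 \<and>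
      (0 < representation B x u + e * representation B q u \<longleftrightarrow>
        (if 0 < representation B q u then 0 \<le> representation B x u else 0 < representation B x u)))"
  have "\<forall>\<^sub>F e in at_right 0. \<forall>B\<in>bases. \<forall>u\<in>B. K B u e"
    unfolding K_def using q(3)
    by (intro eventually_ball_finite ballI finite_bases finite_basis perturbed_sign) auto
  moreover have "\<forall>\<^sub>F e in at_right 0. 0 < (e::real)"
    by (simp add: eventually_at_right_less)
  ultimately have "\<forall>\<^sub>F e in at_right (0::real). 0 < e \<and> (\<forall>B\<in>bases. \<forall>u\<in>B. K B u e)"
    by eventually_elim simp
  then obtain e where e: "0 < e" and K: "\<And>B u. B \<in> bases \<Longrightarrow> u \<in> B \<Longrightarrow> K B u e"
    using eventually_happens'[OF trivial_limit_at_right_real] by blast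
  \<comment> \<open>The shifted point is generic, and it has positive coordinates in a basis exactly
    if \<open>x\<close> lies in the half-open cone of that basis.\<close>
  define z where "z = x + e *\<^sub>R q"
  have coord: "representation B z u = representation B x u + e * representation B q u" if "B \<in> bases" for B u
    using that by (simp add: z_def coord_add coord_scale)
  have mem: "x \<in> half_open_cone q B \<longleftrightarrow> (\<forall>u\<in>B. 0 < representation B z u)" if "B \<in> bases" for B
    unfolding half_open_cone_def using K[OF that] coord[OF that] by (simp add: K_def)
  have "z \<in> cone_V"
    unfolding z_def using e q(1) x by (intro cone_add cone_scale) auto
  moreover have "0 < z $ h"
    using cone_height_nonneg[OF x] e q(2) by (simp add: z_def add_nonneg_pos)
  moreover have "representation B z u \<noteq> 0" if "B \<in> bases" "u \<in> B" for B u
    using K[OF that] coord[OF that(1)] by (simp add: K_def)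
  ultimately obtain B where "B \<in> optimal_bases c" "\<forall>u\<in>B. 0 < representation B z u"
    using optimal_basis_exists[OF _ _ _ c] by blast
  moreover have "B1 = B2" if "B1 \<in> optimal_bases c" "B2 \<in> optimal_bases c"
    "\<forall>u\<in>B1. 0 < representation B1 z u" "\<forall>u\<in>B2. 0 < representation B2 z u" for B1 B2
    using optimal_basis_unique that by blast
  moreover have "B \<in> bases" if "B \<in> optimal_bases c" for B
    using that by (simp add: optimal_bases_def)
  ultimately show ?thesis
    using mem by (intro ex_ex1I) blast+
qed

lemma half_open_subset_cone:
  assumes "B \<in> bases"
  shows "half_open_cone q B \<subseteq> cone_V"
proof
  fix x assume "x \<in> half_open_cone q B"
  then have "0 \<le> representation B x u" if "u \<in> B" for u
    using that unfolding half_open_cone_def by (auto split: if_splits intro: less_imp_le)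
  then show "x \<in> cone_V"
    using coord_nonneg_imp_cone[OF assms] by blast
qed

text \<open>Both conditions avoid the zeros of finitely many nonzero linear forms: the reduced costs
  as forms in \<open>c\<close>, and the coordinates of \<open>q\<close> as forms in its coefficients
  on \<open>V\<close>.\<close>

lemma generic_exist:
  obtains c q where "\<And>B v. B \<in> bases \<Longrightarrow> v \<in> V - B \<Longrightarrow> cost c B v \<noteq> c v"
    "q \<in> cone_V" "0 < q $ h" "\<And>B u. B \<in> bases \<Longrightarrow> u \<in> B \<Longrightarrow> representation B q u \<noteq> 0"
proof -
  \<comment> \<open>Applied to \<open>c\<close>, the form \<open>?g (B, v)\<close> gives the reduced
    cost \<open>c v - cost c B v\<close> for \<open>v\<close> outside \<open>B\<close>. It is
    nonzero because its coefficient at \<open>v\<close> is 1.\<close>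
  let ?g = "\<lambda>(B, v) u. if u = v then 1 else - representation B v u"
  have "finite (SIGMA B:bases. V - B)"
    using finite_V by (intro finite_SigmaI finite_bases) auto
  then obtain c where c: "\<forall>g\<in>?g ` (SIGMA B:bases. V - B). (\<Sum>u\<in>V. g u * c u) \<noteq> 0"
    using generic_positive_weights[OF finite_V, of "?g ` (SIGMA B:bases. V - B)"] by (force split: prod.splits)
  have cost: "cost c B v \<noteq> c v" if "B \<in> bases" "v \<in> V - B" for B v
  proof -
    have "(\<Sum>u\<in>V. ?g (B, v) u * c u) = c v + (\<Sum>u\<in>V - {v}. - representation B v u * c u)"
      using that finite_V by (subst sum.remove[of _ v]) (auto intro!: sum.cong)
    also have "(\<Sum>u\<in>V - {v}. - representation B v u * c u) = (\<Sum>u\<in>B. - representation B v u * c u)"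
      using that basis_subset[OF that(1)] finite_V by (intro sum.mono_neutral_right) (auto simp: coord_outside)
    also have "\<dots> = - cost c B v"
      by (simp add: cost_def sum_negf)
    finally show ?thesis
      using c that by force
  qed
  let ?f = "\<lambda>(B, u) v. representation B v u"
  have "finite (SIGMA B:bases. B)"
    by (intro finite_SigmaI finite_bases finite_basis)
  moreover have "\<exists>v\<in>V. ?f p v \<noteq> 0" if "p \<in> (SIGMA B:bases. B)" for p
  proof -
    obtain B u where p: "p = (B, u)" "B \<in> bases" "u \<in> B" using \<open>p \<in> _\<close> by auto
    then have "u \<in> V" "?f p u \<noteq> 0" using basis_subset coord_basis by auto
    then show ?thesis by blast
  qed
  ultimately obtain a where a: "\<forall>v\<in>V. 0 < a v" "\<forall>g\<in>?f ` (SIGMA B:bases. B). (\<Sum>v\<in>V. g v * a v) \<noteq> 0"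
    using generic_positive_weights[OF finite_V, of "?f ` (SIGMA B:bases. B)"] by blast
  define q where "q = (\<Sum>v\<in>V. a v *\<^sub>R v)"
  have "V \<noteq> {}"
    using span_V by (metis UNIV_not_singleton span_empty)
  then have "0 < q $ h"
    unfolding q_def height_eq_sum[OF order_refl] using a(1) finite_V by (intro sum_pos) auto
  moreover have "q \<in> cone_V"
    unfolding q_def using a(1) by (intro coneI) (auto intro: less_imp_le)
  moreover have "representation B q u \<noteq> 0" if "B \<in> bases" "u \<in> B" for B u
    using a(2) that by (force simp: q_def coord_sum coord_scale mult.commute)
  ultimately show ?thesis
    using that cost by blast
qed

end

section \<open>Generating functions of half-open simplicial cones\<close>

context integral_cone
begin

text \<open>For \<open>u\<close> in \<open>S\<close> the coordinate runs through [0, 1) or (0, 1],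
  matching the boundary convention of \<open>half_open_cone\<close>, so that translates by
  \<open>u\<close> fit together without overlap.\<close>

definition slab :: "real^'n \<Rightarrow> (real^'n) set \<Rightarrow> (real^'n) set \<Rightarrow> (real^'n) set" where
  "slab q B S = {x \<in> half_open_cone q B \<inter> integer_points.
     \<forall>u\<in>S. if 0 < representation B q u then representation B x u < 1 else representation B x u \<le> 1}"

definition slab_series :: "real^'n \<Rightarrow> (real^'n) set \<Rightarrow> (real^'n) set \<Rightarrow> real fps" where
  "slab_series q B S = Abs_fps (\<lambda>n. of_nat (card (slab q B S \<inter> {x. x $ h = real n})))"

lemma slab_subset: "B \<in> bases \<Longrightarrow> slab q B S \<subseteq> cone_V \<inter> integer_points"
  using half_open_subset_cone by (auto simp: slab_def)

lemma finite_slab_slice: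
  assumes "B \<in> bases"
  shows "finite (slab q B S \<inter> {x. x $ h = r})"
  using finite_slice[of r] slab_subset[OF assms, of q S] by (elim finite_subset[rotated]) auto

text \<open>For \<open>S = {}\<close> the slab consists of all integer points of the half-open cone, for \<open>S = B\<close> of those
  in its fundamental parallelepiped. Bounding one more coefficient multiplies the generating function
  by \<open>1 - X\<close>.\<close>

lemma slab_split:
  assumes B: "B \<in> bases" and u: "u \<in> B" "u \<notin> S"
  shows "slab q B S \<inter> {x. x $ h = r} = (slab q B (insert u S) \<inter> {x. x $ h = r}) \<union>
      (\<lambda>x. x + u) ` (slab q B S \<inter> {x. x $ h = r - 1})" (is "?L = ?M \<union> ?R")
    and "slab q B (insert u S) \<inter> (\<lambda>x. x + u) ` (slab q B S \<inter> {x. x $ h = r - 1}) = {}"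
proof -
  have uV: "u \<in> integer_points" "u $ h = 1"
    using basis_subset[OF B] u(1) integral_V height_V by auto
  have coord: "representation B (x + u) w = representation B x w + (if w = u then 1 else 0)" for x w
    using coord_add[OF B] coord_basis[OF B u(1)] by simp
  show "?L = ?M \<union> ?R"
  proof (intro equalityI subsetI)
    fix x assume x: "x \<in> ?L"
    show "x \<in> ?M \<union> ?R"
    proof (cases "x \<in> slab q B (insert u S)")
      case False
      then have big: "if 0 < representation B q u then 1 \<le> representation B x u else 1 < representation B x u"
        using x by (auto simp: slab_def split: if_splits)
      \<comment> \<open>The bound violated at \<open>u\<close> is the lower bound shifted by 1, so
        subtracting \<open>u\<close> stays in the half-open cone.\<close>
      define y where "y = x - u"
      then have xy: "x = y + u" by simp
      have "y \<in> integer_points"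
        unfolding y_def using x uV by (auto simp: slab_def intro: integer_points_diff)
      moreover have "y \<in> half_open_cone q B"
        unfolding half_open_cone_def
      proof (intro CollectI ballI)
        fix w assume "w \<in> B"
        then have "if 0 < representation B q w then 0 \<le> representation B x w else 0 < representation B x w"
          using x by (auto simp: slab_def half_open_cone_def)
        then show "if 0 < representation B q w then 0 \<le> representation B y w else 0 < representation B y w"
          using big coord[of y w] unfolding xy by (auto split: if_splits)
      qed
      moreover have "if 0 < representation B q w then representation B y w < 1 else representation B y w \<le> 1"
        if "w \<in> S" for w
        using x that u(2) coord[of y w] unfolding xy by (auto simp: slab_def split: if_splits)
      ultimately have "y \<in> slab q B S" by (auto simp: slab_def)
      moreover have "y $ h = r - 1" using x uV by (simp add: y_def)
      ultimately show ?thesis using xy by blast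
    qed (use x in auto)
  next
    fix x assume "x \<in> ?M \<union> ?R"
    then show "x \<in> ?L"
    proof
      assume "x \<in> ?R"
      then obtain y where y: "y \<in> slab q B S" "y $ h = r - 1" "x = y + u" by blast
      have "x \<in> integer_points"
        using y uV by (auto simp: slab_def intro: integer_points_add)
      moreover have "x \<in> half_open_cone q B"
        using y(1) unfolding y(3) slab_def half_open_cone_def by (auto simp: coord split: if_splits)
      moreover have "if 0 < representation B q w then representation B x w < 1 else representation B x w \<le> 1"
        if "w \<in> S" for w
        using y(1) that u(2) coord[of y w] unfolding y(3) by (auto simp: slab_def split: if_splits)
      ultimately show ?thesis using y uV by (auto simp: slab_def)
    qed (auto simp: slab_def)
  qed
  show "slab q B (insert u S) \<inter> (\<lambda>x. x + u) ` (slab q B S \<inter> {x. x $ h = r - 1}) = {}"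
    using u(1) by (fastforce simp: slab_def half_open_cone_def coord split: if_splits)
qed

lemma one_minus_X_mult_nth:
  "fps_nth ((1 - fps_X) * F) n = fps_nth F n - (if n = 0 then 0 else fps_nth F (n - 1))"
  for F :: "real fps"
  by (simp add: left_diff_distrib)

text \<open>Translation by \<open>u\<close> raises the height by 1, so the translated part of the
  splitting contributes \<open>fps_X\<close> times the series.\<close>

lemma slab_series_step:
  assumes B: "B \<in> bases" and u: "u \<in> B" "u \<notin> S"
  shows "(1 - fps_X) * slab_series q B S = slab_series q B (insert u S)"
proof (rule fps_ext)
  fix n
  let ?A = "\<lambda>S r. slab q B S \<inter> {x. x $ h = r}"
  have "card (?A S (real n)) = card (?A (insert u S) (real n)) + card ((\<lambda>x. x + u) ` ?A S (real n - 1))"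
    unfolding slab_split(1)[OF assms, of q "real n"] using slab_split(2)[OF assms, of q "real n"]
    by (intro card_Un_disjoint finite_slab_slice[OF B] finite_imageI) auto
  also have "card ((\<lambda>x. x + u) ` ?A S (real n - 1)) = card (?A S (real n - 1))"
    by (intro card_image) auto
  finally have card: "card (?A S (real n)) = card (?A (insert u S) (real n)) + card (?A S (real n - 1))" .
  \<comment> \<open>For \<open>n = 0\<close> the preceding slice is at height -1.\<close>
  have "?A S (- 1) = {}"
    using slab_subset[OF B, of q S] cone_height_nonneg by fastforce
  then have "real (card (?A S (real n - 1))) = (if n = 0 then 0 else fps_nth (slab_series q B S) (n - 1))"
    by (cases n) (auto simp: slab_series_def)
  then show "fps_nth ((1 - fps_X) * slab_series q B S) n = fps_nth (slab_series q B (insert u S)) n"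
    unfolding one_minus_X_mult_nth using card by (simp add: slab_series_def)
qed

lemma slab_series_power:
  assumes "B \<in> bases" "finite S" "S \<subseteq> B"
  shows "(1 - fps_X) ^ card S * slab_series q B {} = slab_series q B S"
  using assms(2,3)
proof (induction S)
  case (insert u S)
  then show ?case
    using slab_series_step[OF assms(1), of u S q] by (simp add: mult.assoc)
qed simp

text \<open>In the parallelepiped the height is a sum of \<open>CARD('n)\<close> coordinates, all at
  most 1.\<close>

lemma slab_series_vanishes:
  assumes B: "B \<in> bases" and q: "0 < q $ h" and n: "CARD('n) \<le> n"
  shows "fps_nth (slab_series q B B) n = 0"
proof -
  have "slab q B B \<inter> {x. x $ h = real n} = {}"
  proof (rule ccontr)
    assume "slab q B B \<inter> {x. x $ h = real n} \<noteq> {}"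
    then obtain x where x: "x \<in> slab q B B" "x $ h = real n" by blast
    \<comment> \<open>As \<open>q\<close> has positive height, it has a positive coordinate, where
      the upper bound is strict. This excludes the height \<open>CARD('n)\<close> itself.\<close>
    obtain w where w: "w \<in> B" "0 < representation B q w"
      using height_coord[OF B, of q] q sum_nonpos[of B "representation B q"] by (force simp: not_less)
    have "(\<Sum>u\<in>B. representation B x u) < (\<Sum>u\<in>B. 1)"
      using x(1) w finite_basis[OF B] unfolding slab_def
      by (intro sum_strict_mono_ex1) (auto split: if_splits intro: less_imp_le)
    then show False
      using height_coord[OF B, of x] x(2) card_basis[OF B] n by simp
  qed
  then show ?thesis by (simp add: slab_series_def)
qed

text \<open>The half-open cones of the optimal bases partition the integer points of the cone, and
  each contributes a polynomial of degree below \<open>CARD('n)\<close> over the common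
  denominator.\<close>

theorem cone_series_rational:
  assumes "CARD('n) \<le> n"
  shows "fps_nth ((1 - fps_X) ^ CARD('n) *
    Abs_fps (\<lambda>n. real (card (cone_V \<inter> {x. x $ h = real n} \<inter> integer_points)))) n = 0"
proof -
  obtain c q where c: "\<And>B v. B \<in> bases \<Longrightarrow> v \<in> V - B \<Longrightarrow> cost c B v \<noteq> c v"
    and q: "q \<in> cone_V" "0 < q $ h" "\<And>B u. B \<in> bases \<Longrightarrow> u \<in> B \<Longrightarrow> representation B q u \<noteq> 0"
    using generic_exist by metis
  let ?O = "optimal_bases c"
  have O: "finite ?O" "?O \<subseteq> bases"
    using finite_bases by (auto simp: optimal_bases_def)
  have decomp: "cone_V \<inter> {x. x $ h = r} \<inter> integer_points = (\<Union>B\<in>?O. slab q B {} \<inter> {x. x $ h = r})" for r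
  proof (intro equalityI subsetI)
    fix x assume "x \<in> cone_V \<inter> {x. x $ h = r} \<inter> integer_points"
    then show "x \<in> (\<Union>B\<in>?O. slab q B {} \<inter> {x. x $ h = r})"
      using half_open_decomposition[OF q c, of x] by (auto simp: slab_def)
  next
    fix x assume "x \<in> (\<Union>B\<in>?O. slab q B {} \<inter> {x. x $ h = r})"
    then show "x \<in> cone_V \<inter> {x. x $ h = r} \<inter> integer_points"
      using O(2) slab_subset by blast
  qed
  have "card (cone_V \<inter> {x. x $ h = r} \<inter> integer_points) = (\<Sum>B\<in>?O. card (slab q B {} \<inter> {x. x $ h = r}))" for r
    unfolding decomp
  proof (intro card_UN_disjoint O ballI impI)
    show "finite (slab q B {} \<inter> {x. x $ h = r})" if "B \<in> ?O" for B
      using that O(2) finite_slab_slice by blast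
    show "slab q B {} \<inter> {x. x $ h = r} \<inter> (slab q B' {} \<inter> {x. x $ h = r}) = {}"
      if "B \<in> ?O" "B' \<in> ?O" "B \<noteq> B'" for B B'
    proof -
      have "\<not> (x \<in> half_open_cone q B \<and> x \<in> half_open_cone q B')" for x
        using half_open_decomposition[OF q c, of x] half_open_subset_cone that O(2) by blast
      then show ?thesis by (auto simp: slab_def)
    qed
  qed
  then have "Abs_fps (\<lambda>n. real (card (cone_V \<inter> {x. x $ h = real n} \<inter> integer_points))) =
      (\<Sum>B\<in>?O. slab_series q B {})"
    by (intro fps_ext) (simp add: fps_sum_nth slab_series_def)
  then have "(1 - fps_X) ^ CARD('n) * Abs_fps (\<lambda>n. real (card (cone_V \<inter> {x. x $ h = real n} \<inter> integer_points))) =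
      (\<Sum>B\<in>?O. (1 - fps_X) ^ card B * slab_series q B {})"
    using O(2) card_basis by (simp add: sum_distrib_left subset_iff)
  also have "\<dots> = (\<Sum>B\<in>?O. slab_series q B B)"
    using O(2) finite_basis by (intro sum.cong refl slab_series_power) auto
  finally show ?thesis
    using O(2) slab_series_vanishes[OF _ q(2) assms] by (simp add: fps_sum_nth subset_iff)
qed

end

subsection \<open>Existence of the \<open>\<delta>\<close>-vector\<close>

lemma append_coord_nth [simp]:
  "append_coord x t $ None = t" "append_coord x t $ Some i = x $ i"
  by (simp_all add: append_coord_def)

lemma append_coord_cases:
  obtains x t where "z = append_coord x t"
proof
  show "z = append_coord (\<chi> i. z $ Some i) (z $ None)"
    by (simp add: vec_eq_iff split_option_all)
qed

lemma append_coord_eq_iff [simp]: "append_coord x s = append_coord y t \<longleftrightarrow> x = y \<and> s = t"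
  by (auto simp: vec_eq_iff split_option_all)

lemma append_coord_0 [simp]: "append_coord 0 0 = 0"
  and append_coord_add: "append_coord x s + append_coord y t = append_coord (x + y) (s + t)"
  and append_coord_scale: "r *\<^sub>R append_coord x s = append_coord (r *\<^sub>R x) (r * s)"
  by (auto simp: vec_eq_iff split_option_all)

lemma inner_append_coord: "append_coord x s \<bullet> append_coord y t = x \<bullet> y + s * t"
  by (simp add: inner_vec_def UNIV_option_conv sum.reindex)

lemma append_coord_integer_points:
  "append_coord x t \<in> integer_points \<longleftrightarrow> x \<in> integer_points \<and> t \<in> \<int>"
  by (auto simp: integer_points_def split_option_all)

lemma convex_hull_append_coord:
  assumes "finite W"
  shows "convex hull ((\<lambda>w. append_coord w t) ` W) = (\<lambda>x. append_coord x t) ` (convex hull W)"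
proof -
  have lin: "linear (\<lambda>x. append_coord x 0)"
    by (intro linearI) (simp_all add: append_coord_add append_coord_scale)
  have eq: "(\<lambda>w. append_coord w t) ` S = (+) (append_coord 0 t) ` (\<lambda>x. append_coord x 0) ` S" for S
    by (simp add: image_image append_coord_add)
  show ?thesis
    unfolding eq by (simp add: convex_hull_translation convex_hull_linear_image[OF lin])
qed

text \<open>If the lifted points did not span, a vector orthogonal to them would place
  \<open>W\<close> in a hyperplane, whose interior is empty.\<close>

lemma integral_cone_homogenization:
  fixes W :: "(real^'n) set"
  assumes W: "finite W" "W \<subseteq> integer_points" and int: "interior (convex hull W) \<noteq> {}"
  shows "integral_cone ((\<lambda>w. append_coord w 1) ` W) None"
proof
  let ?V = "(\<lambda>w. append_coord w 1) ` W"
  show "finite ?V" using W by simp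
  show "?V \<subseteq> integer_points"
    using W by (auto simp: append_coord_integer_points)
  show "v $ None = 1" if "v \<in> ?V" for v
    using that by auto
  show "span ?V = UNIV"
  proof (rule ccontr)
    assume "span ?V \<noteq> UNIV"
    then obtain z where z: "z \<noteq> 0" "\<forall>x\<in>span ?V. z \<bullet> x = 0"
      using span_not_UNIV_orthogonal by blast
    obtain a t where at: "z = append_coord a t" by (rule append_coord_cases)
    have orth: "a \<bullet> w = - t" if "w \<in> W" for w
      using z(2) span_base[of "append_coord w 1" ?V] that by (force simp: at inner_append_coord)
    have "W \<noteq> {}" using int by auto
    then have "a \<noteq> 0" using orth z(1) by (auto simp: at)
    have "convex hull W \<subseteq> {x. a \<bullet> x = - t}"
      using orth by (intro hull_minimal) (auto simp: convex_hyperplane)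
    then have "interior (convex hull W) \<subseteq> interior {x. a \<bullet> x = - t}"
      by (rule interior_mono)
    then show False
      using interior_hyperplane[OF \<open>a \<noteq> 0\<close>] int by auto
  qed
qed

text \<open>The integer points of the \<open>n\<close>-th dilate are those of the homogenized cone
  at height \<open>n\<close>. This cone lives in dimension \<open>CARD('n) + 1\<close>, the exponent
  of the denominator.\<close>

theorem delta_vector_exists:
  fixes W :: "(real^'n) set"
  assumes W: "finite W" "W \<subseteq> integer_points" and int: "interior (convex hull W) \<noteq> {}"
  shows "\<exists>\<delta>. is_delta_vector (convex hull W) \<delta>"
proof -
  let ?V = "(\<lambda>w. append_coord w 1) ` W" and ?P = "convex hull W" and ?d = "CARD('n) + 1"
  interpret integral_cone ?V None
    by (rule integral_cone_homogenization[OF assms])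
  have "card (cone_V \<inter> {x. x $ None = real n} \<inter> integer_points) =
      (if n = 0 then 1 else card ((\<lambda>x. real n *\<^sub>R x) ` ?P \<inter> integer_points))" for n
  proof (cases "n = 0")
    case True
    \<comment> \<open>Height 0 carries only the apex, in agreement with the constant term 1 of the
      series.\<close>
    have "0 \<in> cone_V" using coneI[of "{}"] by simp
    then have "cone_V \<inter> {x. x $ None = real n} \<inter> integer_points = {0}"
      using cone_height_zero True by (auto simp: integer_points_def)
    then show ?thesis using True by simp
  next
    case False
    have "cone_V \<inter> {x. x $ None = real n} = (\<lambda>x. append_coord x (real n)) ` (\<lambda>x. real n *\<^sub>R x) ` ?P"
      using cone_eq_convex_hull[of "real n"] False
      by (auto simp: convex_hull_append_coord[OF W(1)] image_image append_coord_scale)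
    then have "cone_V \<inter> {x. x $ None = real n} \<inter> integer_points =
        (\<lambda>x. append_coord x (real n)) ` ((\<lambda>x. real n *\<^sub>R x) ` ?P \<inter> integer_points)"
      by (auto simp: append_coord_integer_points)
    then show ?thesis
      using False by (simp add: card_image inj_on_def)
  qed
  then have E: "Ehrhart_series ?P =
      Abs_fps (\<lambda>n. real (card (cone_V \<inter> {x. x $ None = real n} \<inter> integer_points)))"
    unfolding Ehrhart_series_def by (intro fps_ext) simp
  let ?D = "(1 - fps_X) ^ ?d :: real fps"
  define N where "N = ?D * Ehrhart_series ?P"
  have D: "fps_nth ?D 0 \<noteq> 0"
    by (simp add: fps_nth_power_0)
  define \<delta> where "\<delta> = map (fps_nth N) [0..<?d]"
  have "N = (\<Sum>i\<le>CARD('n). fps_const (\<delta> ! i) * fps_X ^ i)"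
  proof (rule fps_ext)
    fix k
    have "fps_nth (\<Sum>i\<le>CARD('n). fps_const (\<delta> ! i) * fps_X ^ i) k =
        (\<Sum>i\<le>CARD('n). if i = k then \<delta> ! i else 0)"
      unfolding fps_sum_nth by (intro sum.cong refl) (auto simp: fps_X_power_nth)
    also have "\<dots> = (if k \<le> CARD('n) then \<delta> ! k else 0)" by simp
    also have "\<dots> = fps_nth N k"
    proof (cases "k \<le> CARD('n)")
      case True
      then show ?thesis by (simp add: \<delta>_def del: upt_Suc)
    next
      \<comment> \<open>In the homogenized space the vanishing starts at
        \<open>CARD('n) + 1\<close>, right after the last entry of \<open>\<delta>\<close>.\<close>
      case False
      then show ?thesis
        using cone_series_rational[of k] unfolding N_def E by (simp add: card_option)
    qed
    finally show "fps_nth N k = fps_nth (\<Sum>i\<le>CARD('n). fps_const (\<delta> ! i) * fps_X ^ i) k" by simp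
  qed
  moreover have "Ehrhart_series ?P = N / ?D"
    using D fps_divide_unit[OF D, of N] inverse_mult_eq_1[OF D]
    by (simp add: N_def mult.commute mult.left_commute)
  ultimately have "is_delta_vector ?P \<delta>"
    by (simp add: is_delta_vector_def \<delta>_def del: upt_Suc)
  then show ?thesis by blast
qed

text \<open>Existence makes the description by \<open>THE\<close> meaningful, so the vector
  determines the series. Conversely, \<open>is_delta_vector\<close> sees the polytope only through
  its series.\<close>

lemma delta_vector_eq_iff:
  fixes P Q :: "(real^'n) set"
  assumes "\<exists>\<delta>. is_delta_vector P \<delta>" "\<exists>\<delta>. is_delta_vector Q \<delta>"
  shows "delta_vector P = delta_vector Q \<longleftrightarrow> Ehrhart_series P = Ehrhart_series Q"
proof
  have the: "delta_vector R = \<delta>" if "is_delta_vector R \<delta>" for R :: "(real^'n) set" and \<delta>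
    unfolding delta_vector_def using that delta_vector_unique by (intro the_equality) auto
  show "Ehrhart_series P = Ehrhart_series Q" if eq: "delta_vector P = delta_vector Q"
  proof -
    obtain \<delta> where \<delta>: "is_delta_vector P \<delta>" "is_delta_vector Q \<delta>"
      using assms eq the by metis
    then show ?thesis
      unfolding is_delta_vector_def by simp
  qed
  show "delta_vector P = delta_vector Q" if "Ehrhart_series P = Ehrhart_series Q"
    using that by (simp add: delta_vector_def is_delta_vector_def)
qed

subsection \<open>The polytope \<open>\<Gamma>(P)\<close> and its dual\<close>

lemma zero_in_integer_points: "0 \<in> integer_points"
  by (simp add: integer_points_def)

text \<open>By Krein-Milman a polytope is the hull of its extreme points, which belong to any finite
  generating set.\<close>

lemma integral_polytope_eq_hull:
  fixes P :: "(real^'n) set"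
  assumes "integral_polytope P"
  obtains W where "finite W" "W \<subseteq> integer_points" "P = convex hull W"
proof -
  obtain v where v: "finite v" "P = convex hull v"
    using assms by (auto simp: integral_polytope_def polytope_def)
  let ?W = "{x. x extreme_point_of P}"
  have "?W \<subseteq> v"
    using v(2) extreme_point_of_convex_hull by blast
  then have "finite ?W"
    using v(1) finite_subset by blast
  moreover have "?W \<subseteq> integer_points"
    using assms by (auto simp: integral_polytope_def)
  moreover have "P = convex hull ?W"
    using Krein_Milman_polytope[OF v(1)] v(2) by simp
  ultimately show ?thesis using that by blast
qed

section \<open>Dual polytopes and their interior integer points\<close>

lemma dual_polytope_convex_hull: "dual_polytope (convex hull S) = dual_polytope S"
proof
  show "dual_polytope (convex hull S) \<subseteq> dual_polytope S"
    using hull_subset[of S convex] by (auto simp: dual_polytope_def)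
  show "dual_polytope S \<subseteq> dual_polytope (convex hull S)"
  proof
    fix y assume "y \<in> dual_polytope S"
    then have "convex hull S \<subseteq> {x. y \<bullet> x \<le> 1}"
      by (intro hull_minimal convex_halfspace_le) (auto simp: dual_polytope_def inner_commute)
    then show "y \<in> dual_polytope (convex hull S)"
      by (auto simp: dual_polytope_def inner_commute)
  qed
qed

text \<open>If \<open>S\<close> lies in a ball of radius \<open>r\<close>, Cauchy-Schwarz puts the
  ball of radius \<open>1 / r\<close> into the dual.\<close>

lemma zero_in_interior_dual:
  fixes S :: "(real^'n) set"
  assumes "bounded S"
  shows "0 \<in> interior (dual_polytope S)"
proof -
  obtain r where r: "0 < r" "\<And>x. x \<in> S \<Longrightarrow> norm x \<le> r"
    using assms bounded_pos by blast
  have "ball 0 (1 / r) \<subseteq> dual_polytope S"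
  proof
    fix y :: "real^'n" assume "y \<in> ball 0 (1 / r)"
    then have y: "norm y \<le> 1 / r" by simp
    have "x \<bullet> y \<le> 1" if "x \<in> S" for x
    proof -
      have "x \<bullet> y \<le> norm x * norm y" by (rule norm_cauchy_schwarz)
      also have "\<dots> \<le> r * (1 / r)" using r y that by (intro mult_mono) auto
      finally show ?thesis using r(1) by simp
    qed
    then show "y \<in> dual_polytope S" by (simp add: dual_polytope_def)
  qed
  then show ?thesis
    using r(1) by (meson centre_in_ball divide_pos_pos interior_maximal open_ball subsetD zero_less_one)
qed

lemma nonpos_on_neighbourhood_imp_zero:
  fixes S :: "(real^'n) set"
  assumes "0 \<in> interior S" "\<And>x. x \<in> S \<Longrightarrow> x \<bullet> y \<le> 0"
  shows "y = 0"
proof -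
  obtain e where e: "0 < e" "ball 0 e \<subseteq> S"
    using assms(1) mem_interior by blast
  show ?thesis
  proof (rule ccontr)
    assume "y \<noteq> 0"
    then have "norm ((e / (2 * norm y)) *\<^sub>R y) < e" using e(1) by simp
    then have "(e / (2 * norm y)) *\<^sub>R y \<in> S" using e(2) by (auto simp: dist_norm)
    then have "(e / (2 * norm y)) * (y \<bullet> y) \<le> 0" using assms(2) by fastforce
    moreover have "0 < (e / (2 * norm y)) * (y \<bullet> y)"
      using \<open>y \<noteq> 0\<close> e(1) by (intro mult_pos_pos) auto
    ultimately show False by linarith
  qed
qed

text \<open>An interior point can be stretched slightly within the dual, so its pairings with
  \<open>W\<close> are less than 1; being integers, they are at most 0. Thus \<open>y\<close> is
  nonpositive on a neighbourhood of 0.\<close>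

lemma interior_dual_integer_points:
  fixes W :: "(real^'n) set"
  assumes W: "W \<subseteq> integer_points" and int: "0 \<in> interior (convex hull W)"
    and y: "y \<in> interior (dual_polytope (convex hull W))" "y \<in> integer_points"
  shows "y = 0"
proof -
  obtain e where e: "0 < e" "ball y e \<subseteq> dual_polytope (convex hull W)"
    using y(1) mem_interior by blast
  \<comment> \<open>Chosen so that \<open>r * norm y < e\<close>; the summand 1 keeps the
    denominator positive for \<open>y = 0\<close>.\<close>
  define r where "r = e / (2 * (norm y + 1))"
  have ny: "0 < norm y + 1" by (simp add: add_nonneg_pos)
  have r: "0 < r" using e(1) ny by (simp add: r_def)
  have "norm (r *\<^sub>R y) < e"
  proof -
    have "r * norm y \<le> r * (norm y + 1)" using r by simp
    also have "\<dots> = e / 2" using ny by (simp add: r_def field_simps)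
    finally show ?thesis using r e(1) by simp
  qed
  then have "y + r *\<^sub>R y \<in> ball y e" by (simp add: dist_norm)
  then have dual: "y + r *\<^sub>R y \<in> dual_polytope W"
    using e(2) dual_polytope_convex_hull by blast
  have nonpos: "y \<bullet> w \<le> 0" if "w \<in> W" for w
  proof -
    have le: "(1 + r) * (w \<bullet> y) \<le> 1"
      using dual that by (auto simp: dual_polytope_def inner_add_right algebra_simps)
    have "w \<bullet> y < 1"
    proof (rule ccontr)
      assume "\<not> w \<bullet> y < 1"
      then have "(1 + r) * 1 \<le> (1 + r) * (w \<bullet> y)"
        using r by (intro mult_left_mono) auto
      then have "1 + r \<le> 1" using le by (metis mult.right_neutral order_trans)
      then show False using r by simp
    qed
    moreover have "w \<bullet> y \<in> \<int>"
      unfolding inner_vec_def using W y(2) that by (auto simp: integer_points_def intro!: Ints_sum Ints_mult)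
    ultimately have "w \<bullet> y \<le> 0" by (elim Ints_cases) auto
    then show ?thesis by (simp add: inner_commute)
  qed
  then have "convex hull W \<subseteq> {x. y \<bullet> x \<le> 0}"
    by (intro hull_minimal convex_halfspace_le) auto
  then have "x \<bullet> y \<le> 0" if "x \<in> convex hull W" for x
    using that inner_commute[of x y] by auto
  then show ?thesis
    by (rule nonpos_on_neighbourhood_imp_zero[OF int])
qed

section \<open>Slices of \<open>Gamma_polytope P\<close> and of its dual\<close>

lemma convex_scale_zero:
  fixes P :: "(real^'n) set"
  assumes "convex P" "0 \<in> P" "x \<in> P" "0 \<le> r" "r \<le> 1"
  shows "r *\<^sub>R x \<in> P"
  using convexD[OF assms(1,2,3), of "1 - r" r] assms(4,5) by simp

text \<open>Every point of the hull lies on a segment from the apex to the convex prism over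
  \<open>P\<close>: up to height 0 the slices are copies of \<open>P\<close>, above it they shrink
  linearly.\<close>

lemma mem_Gamma_polytope:
  fixes P :: "(real^'n) set"
  assumes P: "convex P" "0 \<in> P"
  shows "append_coord x t \<in> Gamma_polytope P \<longleftrightarrow>
    - 1 \<le> t \<and> t \<le> 1 \<and> x \<in> (\<lambda>y. (1 - max t 0) *\<^sub>R y) ` P"
proof -
  let ?S = "{append_coord x t |x t. x \<in> P \<and> t \<in> {-1..0}}"
  have "convex ?S"
  proof (rule convexI)
    fix p q u v assume "p \<in> ?S" "q \<in> ?S" and uv: "0 \<le> u" "0 \<le> v" "u + v = (1::real)"
    then obtain x s y t where "p = append_coord x s" "q = append_coord y t" "x \<in> P" "y \<in> P"
      "s \<in> {-1..0}" "t \<in> {-1..0}" by blast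
    moreover from this have "u *\<^sub>R s + v *\<^sub>R t \<in> {-1..0}"
      using convexD[OF convex_closed_interval, of s "-1" 0 t u v] uv by simp
    ultimately show "u *\<^sub>R p + v *\<^sub>R q \<in> ?S"
      using convexD[OF P(1)] uv by (auto simp: append_coord_scale append_coord_add)
  qed
  moreover have ne: "?S \<noteq> {}" using P(2) by force
  ultimately have "Gamma_polytope P = {z. \<exists>u\<ge>0. \<exists>v\<ge>0. \<exists>b. u + v = 1 \<and> b \<in> ?S \<and> z = u *\<^sub>R append_coord 0 1 + v *\<^sub>R b}"
    unfolding Gamma_polytope_def Un_insert_right sup_bot_right
    by (subst convex_hull_insert[OF ne]) (simp add: hull_same)
  then have mem: "append_coord x t \<in> Gamma_polytope P \<longleftrightarrow>
      (\<exists>u\<ge>0. \<exists>v\<ge>0. \<exists>y\<in>P. \<exists>s\<in>{-1..0}. u + v = 1 \<and> x = v *\<^sub>R y \<and> t = u + v * s)"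
    by (fastforce simp: append_coord_scale append_coord_add)
  show ?thesis
  proof
    assume "append_coord x t \<in> Gamma_polytope P"
    then obtain u v y s where *: "0 \<le> u" "0 \<le> v" "y \<in> P" "-1 \<le> s" "s \<le> 0" "u + v = 1"
      "x = v *\<^sub>R y" "t = u + v * s" using mem by auto
    have "v * s \<le> 0" "- v \<le> v * s" using * mult_left_mono[of "-1" s v] by (auto simp: mult_nonneg_nonpos)
    then have t: "- 1 \<le> t" "t \<le> 1" "v \<le> 1 - t" using * by auto
    have "x \<in> (\<lambda>y. (1 - max t 0) *\<^sub>R y) ` P"
    proof (cases "v = 0")
      case True
      then show ?thesis using P(2) *(7) by (intro image_eqI[of _ _ 0]) auto
    next
      case False
      \<comment> \<open>The coefficient \<open>v\<close> may be smaller than the scale of the slice.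
        The quotient is at most 1, so the rescaled \<open>y\<close> stays in \<open>P\<close>, which
        contains 0.\<close>
      define r where "r = v / (1 - max t 0)"
      have pos: "v \<le> 1 - max t 0" "0 < 1 - max t 0" using t * False by auto
      then have "r *\<^sub>R y \<in> P"
        using * by (intro convex_scale_zero P) (auto simp: r_def)
      moreover have "x = (1 - max t 0) *\<^sub>R r *\<^sub>R y" using pos *(7) by (simp add: r_def)
      ultimately show ?thesis by blast
    qed
    then show "- 1 \<le> t \<and> t \<le> 1 \<and> x \<in> (\<lambda>y. (1 - max t 0) *\<^sub>R y) ` P" using t by simp
  next
    assume r: "- 1 \<le> t \<and> t \<le> 1 \<and> x \<in> (\<lambda>y. (1 - max t 0) *\<^sub>R y) ` P"
    then obtain y where "y \<in> P" "x = (1 - max t 0) *\<^sub>R y" by blast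
    \<comment> \<open>For \<open>t \<ge> 0\<close> the segment ends on the upper lid of the prism;
      for \<open>t < 0\<close> the point already lies in the prism.\<close>
    then show "append_coord x t \<in> Gamma_polytope P"
      unfolding mem using r
      by (intro exI[of _ "max t 0"] conjI exI[of _ "1 - max t 0"] bexI[of _ y] bexI[of _ "min t 0"])
        (auto simp: max_def min_def)
  qed
qed

text \<open>For 0 in the interior of \<open>P\<close>, the dual of \<open>Gamma_polytope P\<close>
  has its apex at the bottom; this reflection makes it comparable with
  \<open>Gamma_polytope (dual_polytope P)\<close>.\<close>

definition flip_last :: "real^(('n::finite) option) \<Rightarrow> real^('n option)" where
  "flip_last z = append_coord (\<chi> i. z $ Some i) (- z $ None)"

lemma flip_last_append [simp]: "flip_last (append_coord x t) = append_coord x (- t)"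
  by (auto simp: flip_last_def vec_eq_iff split_option_all)

lemma flip_last_involution [simp]: "flip_last (flip_last z) = z"
  by (auto simp: flip_last_def vec_eq_iff split_option_all)

text \<open>For fixed \<open>x\<close> the constraint is affine in \<open>t\<close>, so only
  \<open>t = 0\<close> and \<open>t = -1\<close> matter; the apex contributes
  \<open>s \<le> 1\<close>.\<close>

lemma mem_dual_Gamma:
  fixes P :: "(real^'n) set"
  assumes P: "0 \<in> P"
  shows "append_coord y s \<in> dual_polytope (Gamma_polytope P) \<longleftrightarrow>
    s \<le> 1 \<and> y \<in> dual_polytope P \<and> (\<forall>x\<in>P. x \<bullet> y \<le> 1 + s)" (is "?L \<longleftrightarrow> ?R")
proof -
  have L: "?L \<longleftrightarrow> s \<le> 1 \<and> (\<forall>x\<in>P. \<forall>t\<in>{-1..0}. x \<bullet> y + t * s \<le> 1)"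
    unfolding Gamma_polytope_def dual_polytope_convex_hull
    by (fastforce simp: dual_polytope_def inner_append_coord)
  have "x \<bullet> y + t * s \<le> 1" if ?R "x \<in> P" "t \<in> {-1..0}" for x t
  proof -
    \<comment> \<open>The constraint at \<open>t\<close> is the combination of the two endpoint
      constraints with weights \<open>1 + t\<close> and \<open>- t\<close>.\<close>
    have "(1 + t) * (x \<bullet> y) \<le> (1 + t) * 1" "(- t) * (x \<bullet> y) \<le> (- t) * (1 + s)"
      using that by (intro mult_left_mono; auto simp: dual_polytope_def)+
    then show ?thesis by (simp add: algebra_simps)
  qed
  moreover have ?R if "s \<le> 1" "\<forall>x\<in>P. \<forall>t\<in>{-1..0}. x \<bullet> y + t * s \<le> 1"
    using that(1) bspec[OF bspec[OF that(2)], of _ 0] bspec[OF bspec[OF that(2)], of _ "- 1"]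
    by (fastforce simp: dual_polytope_def)
  ultimately show ?thesis using L by blast
qed

lemma convex_dual_polytope: "convex (dual_polytope S)"
  by (auto simp: dual_polytope_def convex_def inner_add_right intro: convex_bound_le)

lemma zero_in_dual_polytope: "0 \<in> dual_polytope S"
  by (simp add: dual_polytope_def)

text \<open>For \<open>s \<ge> 0\<close> the bound \<open>1 + s\<close> follows from
  \<open>y \<in> dual_polytope P\<close>. For \<open>s < 0\<close> it puts \<open>y\<close> into the
  dual scaled by \<open>1 + s\<close>, so the slices shrink towards height -1.\<close>

lemma dual_Gamma_flip:
  fixes P :: "(real^'n) set"
  assumes P: "0 \<in> interior P"
  shows "dual_polytope (Gamma_polytope P) = flip_last ` Gamma_polytope (dual_polytope P)"
proof -
  have P0: "0 \<in> P" using P interior_subset by blast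
  have eq: "append_coord y s \<in> dual_polytope (Gamma_polytope P) \<longleftrightarrow>
      append_coord y (- s) \<in> Gamma_polytope (dual_polytope P)" for y s
    unfolding mem_dual_Gamma[OF P0] mem_Gamma_polytope[OF convex_dual_polytope zero_in_dual_polytope]
  proof
    assume L: "s \<le> 1 \<and> y \<in> dual_polytope P \<and> (\<forall>x\<in>P. x \<bullet> y \<le> 1 + s)"
    then have s: "- 1 \<le> s" using P0 by force
    have "y \<in> (\<lambda>y. (1 - max (- s) 0) *\<^sub>R y) ` dual_polytope P"
    proof (cases "0 \<le> s")
      case True
      then show ?thesis using L by simp
    next
      case False
      show ?thesis
      proof (cases "s = - 1")
        case True
        \<comment> \<open>Here the scale is 0 and cannot be divided out, but \<open>y\<close> is
          nonpositive on \<open>P\<close>.\<close>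
        then have "y = 0" using L nonpos_on_neighbourhood_imp_zero[OF P] by simp
        then show ?thesis using True zero_in_dual_polytope by force
      next
        case s1: False
        then have pos: "0 < 1 + s" using s by simp
        have "(1 / (1 + s)) *\<^sub>R y \<in> dual_polytope P"
          using L pos by (simp add: dual_polytope_def)
        then show ?thesis
          using False pos by (intro image_eqI[of _ _ "(1 / (1 + s)) *\<^sub>R y"]) (auto simp: max_def)
      qed
    qed
    then show "- 1 \<le> - s \<and> - s \<le> 1 \<and> y \<in> (\<lambda>y. (1 - max (- s) 0) *\<^sub>R y) ` dual_polytope P"
      using L s by simp
  next
    assume R: "- 1 \<le> - s \<and> - s \<le> 1 \<and> y \<in> (\<lambda>y. (1 - max (- s) 0) *\<^sub>R y) ` dual_polytope P"
    then obtain z where z: "z \<in> dual_polytope P" "y = (1 - max (- s) 0) *\<^sub>R z" by blast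
    have "x \<bullet> y \<le> 1 - max (- s) 0" if "x \<in> P" for x
    proof -
      have "(1 - max (- s) 0) * (x \<bullet> z) \<le> (1 - max (- s) 0) * 1"
        using z(1) that R by (intro mult_left_mono) (auto simp: dual_polytope_def)
      then show ?thesis by (simp add: z(2))
    qed
    then show "s \<le> 1 \<and> y \<in> dual_polytope P \<and> (\<forall>x\<in>P. x \<bullet> y \<le> 1 + s)"
      using R by (fastforce simp: dual_polytope_def)
  qed
  show ?thesis
  proof (intro equalityI subsetI)
    fix z assume z: "z \<in> dual_polytope (Gamma_polytope P)"
    obtain y s where ys: "z = append_coord y s" by (rule append_coord_cases)
    show "z \<in> flip_last ` Gamma_polytope (dual_polytope P)"
      using z eq[of y s] by (intro image_eqI[of _ _ "append_coord y (- s)"]) (simp_all add: ys)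
  next
    fix z assume "z \<in> flip_last ` Gamma_polytope (dual_polytope P)"
    then obtain p where p: "p \<in> Gamma_polytope (dual_polytope P)" "z = flip_last p" by blast
    obtain y s where "p = append_coord y s" by (rule append_coord_cases)
    then show "z \<in> dual_polytope (Gamma_polytope P)" using p eq[of y "- s"] by simp
  qed
qed

text \<open>The reflection commutes with dilations and permutes the integer points.\<close>

lemma Ehrhart_series_flip:
  fixes S :: "(real^(('n::finite) option)) set"
  shows "Ehrhart_series (flip_last ` S) = Ehrhart_series S"
proof -
  have scale: "r *\<^sub>R flip_last z = flip_last (r *\<^sub>R z)" for r and z :: "real^('n option)"
    by (auto simp: flip_last_def vec_eq_iff split_option_all)
  have int: "flip_last z \<in> integer_points \<longleftrightarrow> z \<in> integer_points" for z :: "real^('n option)"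
    by (auto simp: flip_last_def append_coord_integer_points integer_points_def split_option_all)
  have "(\<lambda>x. r *\<^sub>R x) ` flip_last ` S \<inter> integer_points =
      flip_last ` ((\<lambda>x. r *\<^sub>R x) ` S \<inter> integer_points)" for r
  proof -
    have "(\<lambda>x. r *\<^sub>R x) ` flip_last ` S = flip_last ` (\<lambda>x. r *\<^sub>R x) ` S"
      by (simp add: image_image scale)
    then show ?thesis by (auto simp: int)
  qed
  then have "card ((\<lambda>x. r *\<^sub>R x) ` flip_last ` S \<inter> integer_points) =
      card ((\<lambda>x. r *\<^sub>R x) ` S \<inter> integer_points)" for r
    by (metis (no_types) card_image flip_last_involution inj_onI)
  then show ?thesis
    unfolding Ehrhart_series_def by presburger
qed

text \<open>The prism is the hull of its lids at heights 0 and -1, as each of its points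
  interpolates between the lid points above and below it.\<close>

lemma Gamma_polytope_eq_hull:
  fixes W :: "(real^'n) set"
  assumes "finite W" "W \<subseteq> integer_points"
  obtains W' where "finite W'" "W' \<subseteq> integer_points" "Gamma_polytope (convex hull W) = convex hull W'"
proof
  let ?W = "(\<lambda>w. append_coord w 0) ` W \<union> (\<lambda>w. append_coord w (- 1)) ` W \<union> {append_coord 0 1}"
  show "finite ?W" using assms by simp
  show "?W \<subseteq> integer_points"
    using assms(2) zero_in_integer_points by (auto simp: append_coord_integer_points)
  show "Gamma_polytope (convex hull W) = convex hull ?W"
    unfolding Gamma_polytope_def
  proof (rule antisym; rule hull_minimal)
    let ?G = "{append_coord x t |x t. x \<in> convex hull W \<and> t \<in> {- 1..0}} \<union> {append_coord 0 1}"
    have sub: "append_coord x t \<in> convex hull ?W" if "x \<in> convex hull W" "t \<in> {0, - 1}" for x t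
    proof -
      have "append_coord x t \<in> convex hull ((\<lambda>w. append_coord w t) ` W)"
        using that(1) convex_hull_append_coord[OF assms(1)] by blast
      moreover have "convex hull ((\<lambda>w. append_coord w t) ` W) \<subseteq> convex hull ?W"
        using that(2) by (intro hull_mono) auto
      ultimately show ?thesis by blast
    qed
    have "append_coord x t \<in> convex hull ?W" if "x \<in> convex hull W" "t \<in> {- 1..0}" for x t
    proof -
      have "(1 + t) *\<^sub>R append_coord x 0 + (- t) *\<^sub>R append_coord x (- 1) \<in> convex hull ?W"
        using that by (intro convexD[OF convex_convex_hull] sub) auto
      moreover have "(1 + t) *\<^sub>R append_coord x 0 + (- t) *\<^sub>R append_coord x (- 1) = append_coord x t"
        by (simp add: append_coord_scale append_coord_add scaleR_add_left)
      ultimately show ?thesis by simp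
    qed
    moreover have "append_coord 0 1 \<in> convex hull ?W" by (intro hull_inc) simp
    ultimately show "?G \<subseteq> convex hull ?W" by auto
    have "?W \<subseteq> ?G" by (auto intro: hull_inc)
    then show "?W \<subseteq> convex hull ?G" using hull_subset[of ?G convex] by (rule subset_trans)
  qed (rule convex_convex_hull)+
qed

lemma zero_in_interior_Gamma:
  fixes P :: "(real^'n) set"
  assumes "convex P" "0 \<in> interior P"
  shows "0 \<in> interior (Gamma_polytope P)"
proof -
  obtain e where e: "0 < e" "ball 0 e \<subseteq> P"
    using assms(2) mem_interior by blast
  have P0: "0 \<in> P" using assms(2) interior_subset by blast
  \<comment> \<open>For \<open>\<bar>t\<bar> < 1 / 2\<close> the slice has scale above
    \<open>1 / 2\<close>, so it contains every \<open>x\<close> of norm below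
    \<open>e / 2\<close>.\<close>
  have "ball 0 (min (e / 2) (1 / 2)) \<subseteq> Gamma_polytope P"
  proof
    fix z :: "real^('n option)" assume z: "z \<in> ball 0 (min (e / 2) (1 / 2))"
    obtain x t where xt: "z = append_coord x t" by (rule append_coord_cases)
    have nz: "norm z < e / 2" "norm z < 1 / 2" using z by auto
    have "norm x \<le> norm z"
      unfolding norm_le xt inner_append_coord by simp
    moreover have t: "\<bar>t\<bar> \<le> norm z"
      using component_le_norm_cart[of z None] xt by simp
    ultimately have x: "norm x < e / 2" and t2: "\<bar>t\<bar> < 1 / 2" using nz by linarith+
    define r where "r = 1 - max t 0"
    have r: "1 / 2 < r" using t2 by (simp add: r_def)
    have "norm x < e * r" using x mult_strict_left_mono[OF r e(1)] by simp
    then have "norm ((1 / r) *\<^sub>R x) < e" using r by (simp add: field_simps)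
    then have "(1 / r) *\<^sub>R x \<in> P" using e(2) by (auto simp: dist_norm)
    moreover have "x = r *\<^sub>R (1 / r) *\<^sub>R x" using r by simp
    ultimately have "x \<in> (\<lambda>y. (1 - max t 0) *\<^sub>R y) ` P" unfolding r_def by blast
    then show "z \<in> Gamma_polytope P"
      unfolding xt mem_Gamma_polytope[OF assms(1) P0] using t2 by auto
  qed
  then show ?thesis
    using e(1) by (meson centre_in_ball divide_pos_pos interior_maximal min_less_iff_conj open_ball subsetD zero_less_numeral zero_less_one)
qed

section \<open>Counting integer points in dilates of \<open>Gamma_polytope P\<close>\<close>

text \<open>Dilation by 0 leaves one integer point, so the coefficient prescribed at 0 fits the
  counting formula.\<close>

lemma Ehrhart_series_nth:
  fixes P :: "(real^'n) set"
  assumes "P \<noteq> {}"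
  shows "fps_nth (Ehrhart_series P) k = real (card ((\<lambda>x. real k *\<^sub>R x) ` P \<inter> integer_points))"
proof (cases "k = 0")
  case True
  have "(\<lambda>x. real k *\<^sub>R x) ` P \<inter> integer_points = {0}"
    using assms True by (auto simp: zero_in_integer_points)
  then show ?thesis using True by (simp add: Ehrhart_series_def)
qed (simp add: Ehrhart_series_def)

text \<open>Integer points have integer heights, and the slice at height \<open>t\<close> is
  \<open>P\<close> scaled by \<open>n - max t 0\<close>. Nonpositive heights give the first set;
  positive heights \<open>n - k\<close>, with the apex at \<open>k = 0\<close>, give the
  second.\<close>

lemma dilated_Gamma_integer_points:
  fixes P :: "(real^'n) set"
  assumes P: "convex P" "0 \<in> P" and n: "0 < n"
  defines "D \<equiv> \<lambda>k::nat. (\<lambda>x. real k *\<^sub>R x) ` P \<inter> integer_points"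
  shows "(\<lambda>z. real n *\<^sub>R z) ` Gamma_polytope P \<inter> integer_points =
    (\<lambda>(j, x). append_coord x (- real j)) ` ({..n} \<times> D n) \<union>
    (\<lambda>(k, x). append_coord x (real n - real k)) ` (SIGMA k:{..<n}. D k)" (is "?L = ?A \<union> ?B")
proof -
  have L: "append_coord x t \<in> ?L \<longleftrightarrow> - real n \<le> t \<and> t \<le> real n \<and> t \<in> \<int> \<and>
      x \<in> (\<lambda>y. (real n - max t 0) *\<^sub>R y) ` P \<and> x \<in> integer_points" for x t
  proof -
    have max: "max (t / real n) 0 = max t 0 / real n"
      using n by (simp add: max_def zero_le_divide_iff divide_le_0_iff)
    have eq: "real n *\<^sub>R (1 - max t 0 / real n) *\<^sub>R y = (real n - max t 0) *\<^sub>R y" for y :: "real^'n"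
      using n by (simp add: right_diff_distrib)
    have "append_coord x t \<in> (\<lambda>z. real n *\<^sub>R z) ` Gamma_polytope P \<longleftrightarrow>
        append_coord ((1 / real n) *\<^sub>R x) (t / real n) \<in> Gamma_polytope P" (is "?l \<longleftrightarrow> ?r")
    proof
      assume ?l
      then obtain z where z: "z \<in> Gamma_polytope P" "append_coord x t = real n *\<^sub>R z" by blast
      have "append_coord ((1 / real n) *\<^sub>R x) (t / real n) = (1 / real n) *\<^sub>R append_coord x t"
        by (simp add: append_coord_scale)
      also have "\<dots> = z" using z(2) n by simp
      finally show ?r using z(1) by simp
    next
      assume ?r
      then show ?l using n by (intro image_eqI) (auto simp: append_coord_scale)
    qed
    also have "\<dots> \<longleftrightarrow> - real n \<le> t \<and> t \<le> real n \<and>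
        (1 / real n) *\<^sub>R x \<in> (\<lambda>y. (1 - max t 0 / real n) *\<^sub>R y) ` P"
      unfolding mem_Gamma_polytope[OF P] max using n by (simp add: field_simps)
    also have "(1 / real n) *\<^sub>R x \<in> (\<lambda>y. (1 - max t 0 / real n) *\<^sub>R y) ` P \<longleftrightarrow>
        x \<in> (\<lambda>y. (real n - max t 0) *\<^sub>R y) ` P"
    proof
      assume "(1 / real n) *\<^sub>R x \<in> (\<lambda>y. (1 - max t 0 / real n) *\<^sub>R y) ` P"
      then obtain y where y: "y \<in> P" "(1 / real n) *\<^sub>R x = (1 - max t 0 / real n) *\<^sub>R y" by blast
      have "x = real n *\<^sub>R (1 / real n) *\<^sub>R x" using n by simp
      then have "x = (real n - max t 0) *\<^sub>R y" unfolding y(2) eq .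
      then show "x \<in> (\<lambda>y. (real n - max t 0) *\<^sub>R y) ` P" using y(1) by blast
    next
      assume "x \<in> (\<lambda>y. (real n - max t 0) *\<^sub>R y) ` P"
      then obtain y where y: "y \<in> P" "x = real n *\<^sub>R (1 - max t 0 / real n) *\<^sub>R y" unfolding eq by blast
      then show "(1 / real n) *\<^sub>R x \<in> (\<lambda>y. (1 - max t 0 / real n) *\<^sub>R y) ` P"
        using n by (intro image_eqI[of _ _ y]) auto
    qed
    finally show ?thesis by (auto simp: append_coord_integer_points)
  qed
  show ?thesis
  proof (intro equalityI subsetI)
    fix z assume z: "z \<in> ?L"
    obtain x t where xt: "z = append_coord x t" by (rule append_coord_cases)
    obtain i where i: "t = of_int i" using z L[of x t] xt by (auto elim: Ints_cases)
    show "z \<in> ?A \<union> ?B"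
    proof (cases "i \<le> 0")
      case True
      then have t: "t = - real (nat (- i))" by (simp add: i)
      have "nat (- i) \<le> n" "x \<in> D n"
        using z L[of x t] True i unfolding xt D_def by (auto simp: max_def)
      then show ?thesis
        using t xt by (intro UnI1 image_eqI[of _ _ "(nat (- i), x)"]) auto
    next
      case False
      have le: "i \<le> int n" using z L[of x t] i unfolding xt by simp
      define k where "k = nat (int n - i)"
      have k: "k < n" "real n - t = real k" "t = real n - real k" using False le by (auto simp: k_def i)
      have "real n - max t 0 = real k" using False i k by (simp add: max_def)
      then have "x \<in> D k"
        using z L[of x t] unfolding xt D_def by simp
      then show ?thesis
        using k xt by (intro UnI2 image_eqI[of _ _ "(k, x)"]) auto
    qed
  next
    fix z assume "z \<in> ?A \<union> ?B"
    then show "z \<in> ?L"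
    proof
      assume "z \<in> ?A"
      then obtain j x where "j \<le> n" "x \<in> D n" "z = append_coord x (- real j)" by auto
      then show ?thesis using L[of x "- real j"] by (auto simp: D_def)
    next
      assume "z \<in> ?B"
      then obtain k x where "k < n" "x \<in> D k" "z = append_coord x (real n - real k)" by auto
      then show ?thesis using L[of x "real n - real k"] by (auto simp: D_def max_def)
    qed
  qed
qed

text \<open>There are \<open>n + 1\<close> nonpositive heights with full slices, and the positive
  heights contribute each smaller dilate once.\<close>

lemma Ehrhart_series_Gamma:
  fixes P :: "(real^'n) set"
  assumes P: "convex P" "bounded P" "0 \<in> P"
  shows "fps_nth (Ehrhart_series (Gamma_polytope P)) n =
    real (n + 1) * fps_nth (Ehrhart_series P) n + (\<Sum>k<n. fps_nth (Ehrhart_series P) k)"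
proof (cases "n = 0")
  case True
  then show ?thesis by (simp add: Ehrhart_series_def)
next
  case False
  then have n: "0 < n" by simp
  define D where "D = (\<lambda>k::nat. (\<lambda>x. real k *\<^sub>R x) ` P \<inter> integer_points)"
  have P0: "P \<noteq> {}" using P(3) by auto
  have fD: "finite (D k)" for k
    unfolding D_def using P(2) by (intro finite_bounded_integer_points bounded_scaling)
  let ?A = "(\<lambda>(j, x). append_coord x (- real j)) ` ({..n} \<times> D n)"
  let ?B = "(\<lambda>(k, x). append_coord x (real n - real k)) ` (SIGMA k:{..<n}. D k)"
  have "?A \<inter> ?B = {}" by auto
  then have "card (?A \<union> ?B) = card ?A + card ?B"
    using fD by (intro card_Un_disjoint) auto
  also have "card ?A = (n + 1) * card (D n)"
    by (subst card_image) (auto simp: inj_on_def card_cartesian_product)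
  also have "card ?B = (\<Sum>k<n. card (D k))"
    using fD by (subst card_image) (auto simp: inj_on_def card_SigmaI)
  finally have "card ((\<lambda>z. real n *\<^sub>R z) ` Gamma_polytope P \<inter> integer_points) =
      (n + 1) * card (D n) + (\<Sum>k<n. card (D k))"
    using dilated_Gamma_integer_points[OF P(1,3) n] unfolding D_def by simp
  moreover have "fps_nth (Ehrhart_series P) k = real (card (D k))" for k
    unfolding D_def by (rule Ehrhart_series_nth[OF P0])
  ultimately show ?thesis
    using n by (simp add: Ehrhart_series_def algebra_simps)
qed

text \<open>The relation between the coefficients is triangular with diagonal entries
  \<open>n + 1\<close>, so strong induction inverts it.\<close>

lemma Ehrhart_series_Gamma_eq_iff:
  fixes P Q :: "(real^'n) set"
  assumes P: "convex P" "bounded P" "0 \<in> P" and Q: "convex Q" "bounded Q" "0 \<in> Q"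
  shows "Ehrhart_series (Gamma_polytope P) = Ehrhart_series (Gamma_polytope Q) \<longleftrightarrow>
    Ehrhart_series P = Ehrhart_series Q"
proof
  assume eq: "Ehrhart_series (Gamma_polytope P) = Ehrhart_series (Gamma_polytope Q)"
  have "fps_nth (Ehrhart_series P) n = fps_nth (Ehrhart_series Q) n" for n
  proof (induction n rule: less_induct)
    case (less n)
    then have "(\<Sum>k<n. fps_nth (Ehrhart_series P) k) = (\<Sum>k<n. fps_nth (Ehrhart_series Q) k)"
      by (intro sum.cong) auto
    then have "real (n + 1) * fps_nth (Ehrhart_series P) n = real (n + 1) * fps_nth (Ehrhart_series Q) n"
      using Ehrhart_series_Gamma[OF P, of n] Ehrhart_series_Gamma[OF Q, of n] eq by simp
    then show ?case by (simp del: of_nat_add of_nat_Suc add: mult_cancel_left)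
  qed
  then show "Ehrhart_series P = Ehrhart_series Q" by (intro fps_ext)
next
  assume "Ehrhart_series P = Ehrhart_series Q"
  then show "Ehrhart_series (Gamma_polytope P) = Ehrhart_series (Gamma_polytope Q)"
    using Ehrhart_series_Gamma[OF P] Ehrhart_series_Gamma[OF Q] by (intro fps_ext) simp
qed

subsection \<open>Unimodular matrices\<close>

definition integer_matrix :: "real^'n^'m \<Rightarrow> bool" where
  "integer_matrix U \<longleftrightarrow> (\<forall>i j. U $ i $ j \<in> \<int>)"

lemma integer_matrix_mult:
  "integer_matrix A \<Longrightarrow> integer_matrix B \<Longrightarrow> integer_matrix (A ** B)"
  by (auto simp: integer_matrix_def matrix_matrix_mult_def intro!: Ints_sum Ints_mult)

lemma det_integer:
  fixes U :: "real^'n^'n"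
  assumes "integer_matrix U"
  shows "det U \<in> \<int>"
  unfolding det_def using assms by (auto simp: integer_matrix_def intro!: Ints_sum Ints_mult Ints_prod)

text \<open>Cramer's rule gives integer entries of the inverse; conversely, two integer determinants
  with product 1 are units.\<close>

lemma integer_matrix_det_iff_inverse:
  fixes U :: "real^'n^'n"
  assumes U: "integer_matrix U"
  shows "det U = 1 \<or> det U = - 1 \<longleftrightarrow> (\<exists>V. integer_matrix V \<and> U ** V = mat 1)"
proof
  assume det: "det U = 1 \<or> det U = - 1"
  define V :: "real^'n^'n" where
    "V = (\<chi> k j. det (\<chi> a b. if b = k then axis j 1 $ a else U $ a $ b) / det U)"
  have "det (\<chi> a b. if b = k then axis j 1 $ a else U $ a $ b) \<in> \<int>" for k j :: 'n
    using U by (intro det_integer) (auto simp: integer_matrix_def axis_def)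
  then have "integer_matrix V"
    unfolding integer_matrix_def V_def using det by auto
  moreover have "U *v column j V = axis j 1" for j
    using det cramer[of U "column j V" "axis j 1"] by (auto simp: V_def column_def)
  then have "(U ** V) $ i $ j = mat 1 $ i $ j" for i j
  proof -
    have "(U ** V) $ i $ j = (U *v column j V) $ i"
      by (simp add: matrix_matrix_mult_def matrix_vector_mult_def column_def)
    then show ?thesis
      using \<open>\<And>j. U *v column j V = axis j 1\<close> by (simp add: mat_def axis_def)
  qed
  then have "U ** V = mat 1" by (simp add: vec_eq_iff)
  ultimately show "\<exists>V. integer_matrix V \<and> U ** V = mat 1" by blast
next
  assume "\<exists>V. integer_matrix V \<and> U ** V = mat 1"
  then obtain V where V: "integer_matrix V" "U ** V = mat 1" by blast
  obtain m n where mn: "det U = of_int m" "det V = of_int n"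
    using det_integer[OF U] det_integer[OF V(1)] by (auto elim!: Ints_cases)
  have "det U * det V = 1" using V(2) by (metis det_I det_mul)
  then have "m * n = 1" unfolding mn by (metis of_int_eq_1_iff of_int_mult)
  then show "det U = 1 \<or> det U = - 1"
    unfolding mn using zmult_eq_1_iff[of m n] by auto
qed

text \<open>An explicit integer inverse passes through blocks and products more easily than a
  determinant.\<close>

lemma unimodularly_equivalent_altdef:
  "unimodularly_equivalent P Q \<longleftrightarrow> (\<exists>U V w. integer_matrix U \<and> integer_matrix V \<and> U ** V = mat 1 \<and>
     w \<in> integer_points \<and> Q = (\<lambda>v. v v* U + w) ` P)"
  unfolding unimodularly_equivalent_def
  using integer_matrix_det_iff_inverse unfolding integer_matrix_def by blast

definition block_matrix :: "real^'n^'n \<Rightarrow> real \<Rightarrow> real^('n option)^('n option)" where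
  "block_matrix U s = (\<chi> i j. case i of None \<Rightarrow> (case j of None \<Rightarrow> s | Some _ \<Rightarrow> 0)
     | Some i' \<Rightarrow> (case j of None \<Rightarrow> 0 | Some j' \<Rightarrow> U $ i' $ j'))"

lemma block_matrix_nth [simp]:
  "block_matrix U s $ None $ None = s" "block_matrix U s $ None $ Some j = 0"
  "block_matrix U s $ Some i $ None = 0" "block_matrix U s $ Some i $ Some j = U $ i $ j"
  by (simp_all add: block_matrix_def)

lemma sum_option: "(\<Sum>i\<in>UNIV. f i) = f None + (\<Sum>i\<in>UNIV. f (Some i))"
  for f :: "'n::finite option \<Rightarrow> real"
  by (simp add: UNIV_option_conv sum.reindex)

lemma append_coord_block: "append_coord x t v* block_matrix U s = append_coord (x v* U) (t * s)"
  by (simp add: vec_eq_iff split_option_all vector_matrix_mult_def sum_option)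

lemma block_matrix_mult: "block_matrix U s ** block_matrix V r = block_matrix (U ** V) (s * r)"
  by (simp add: vec_eq_iff split_option_all matrix_matrix_mult_def sum_option)

lemma block_matrix_eq_iff: "block_matrix U s = block_matrix V r \<longleftrightarrow> U = V \<and> s = r"
  by (auto simp: vec_eq_iff split_option_all)

lemma block_matrix_mat_1: "block_matrix (mat 1) 1 = mat 1"
  by (simp add: vec_eq_iff split_option_all mat_def)

lemma integer_block_matrix: "integer_matrix (block_matrix U s) \<longleftrightarrow> integer_matrix U \<and> s \<in> \<int>"
  by (auto simp: integer_matrix_def split_option_all)

text \<open>The two equations prescribe the last column and the last row of
  \<open>T\<close>.\<close>

lemma fixes_last_imp_block:
  fixes T :: "real^(('n::finite) option)^('n option)"
  assumes "T *v append_coord 0 1 = append_coord 0 1" "append_coord 0 1 v* T = append_coord 0 1"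
  shows "T = block_matrix (\<chi> i j. T $ Some i $ Some j) 1"
proof -
  have "T $ i $ None = append_coord 0 1 $ i" for i
    using arg_cong[OF assms(1), of "\<lambda>z. z $ i"] by (simp add: matrix_vector_mult_def sum_option)
  moreover have "T $ None $ j = append_coord 0 1 $ j" for j
    using arg_cong[OF assms(2), of "\<lambda>z. z $ j"] by (simp add: vector_matrix_mult_def sum_option)
  ultimately show ?thesis
    by (simp add: vec_eq_iff split_option_all)
qed

subsection \<open>Recovering \<open>P\<close> from \<open>\<Gamma>(P)\<close>\<close>

text \<open>A supporting hyperplane at \<open>x\<close> leaves the interior point 0 strictly on one
  side, so its normal can be scaled to take the value 1 at \<open>x\<close>.\<close>

lemma boundary_point_dual:
  fixes S :: "(real^'n) set"
  assumes "convex S" "0 \<in> interior S" "x \<in> S" "x \<notin> interior S"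
  obtains y where "y \<in> dual_polytope S" "x \<bullet> y = 1"
proof -
  have rel: "rel_interior S = interior S"
    using assms(2) by (intro rel_interior_nonempty_interior) auto
  have x: "x \<in> closure S" "x \<notin> rel_interior S"
    using assms(3,4) closure_subset rel by blast+
  obtain a where a: "\<And>y. y \<in> closure S \<Longrightarrow> a \<bullet> x \<le> a \<bullet> y" "\<And>y. y \<in> rel_interior S \<Longrightarrow> a \<bullet> x < a \<bullet> y"
    by (rule supporting_hyperplane_relative_frontier[OF assms(1) x]) blast
  have neg: "a \<bullet> x < 0"
    using a(2)[of 0] assms(2) rel by simp
  have "(1 / (a \<bullet> x)) *\<^sub>R a \<in> dual_polytope S"
  proof -
    have "(z \<bullet> a) / (a \<bullet> x) \<le> 1" if "z \<in> S" for z
      using a(1)[of z] that closure_subset neg by (auto simp: divide_le_eq inner_commute)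
    then show ?thesis by (simp add: dual_polytope_def)
  qed
  moreover have "x \<bullet> (1 / (a \<bullet> x)) *\<^sub>R a = 1"
    using neg by (simp add: inner_commute)
  ultimately show ?thesis by (rule that)
qed

text \<open>The centre of the base and the outer normal of the base are the same vector. A dual
  vector with value 1 there has last coordinate -1, and its remaining part is nonpositive on
  \<open>P\<close>.\<close>

lemma bottom_point:
  fixes P :: "(real^'n) set"
  assumes P: "convex P" "0 \<in> interior P"
  shows "append_coord 0 (- 1) \<in> Gamma_polytope P"
    and "append_coord 0 (- 1) \<in> dual_polytope (Gamma_polytope P)"
    and "y \<in> dual_polytope (Gamma_polytope P) \<Longrightarrow> append_coord 0 (- 1) \<bullet> y = 1 \<Longrightarrow> y = append_coord 0 (- 1)"
proof -
  have P0: "0 \<in> P" using P(2) interior_subset by blast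
  show "append_coord 0 (- 1) \<in> Gamma_polytope P"
    using P0 by (simp add: mem_Gamma_polytope[OF P(1)])
  show "append_coord 0 (- 1) \<in> dual_polytope (Gamma_polytope P)"
    by (simp add: mem_dual_Gamma[OF P0] zero_in_dual_polytope)
  assume y: "y \<in> dual_polytope (Gamma_polytope P)" "append_coord 0 (- 1) \<bullet> y = 1"
  obtain z s where zs: "y = append_coord z s" by (rule append_coord_cases)
  then have "s = - 1" using y(2) by (simp add: inner_append_coord)
  moreover from this have "z = 0"
    using y(1) nonpos_on_neighbourhood_imp_zero[OF P(2), of z] unfolding zs mem_dual_Gamma[OF P0] by simp
  ultimately show "y = append_coord 0 (- 1)" by (simp add: zs)
qed

text \<open>The base of \<open>\<Gamma>(P)\<close> is its only facet with an integer point in its relative interior,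
  that is, an integer point at which exactly one vector of the dual attains the value 1.\<close>

lemma bottom_point_unique:
  fixes P :: "(real^'n) set"
  assumes P: "convex P" "bounded P" "0 \<in> interior P" "interior P \<inter> integer_points = {0}"
    and p: "p \<in> Gamma_polytope P" "p \<in> integer_points"
    and y: "y \<in> dual_polytope (Gamma_polytope P)" "p \<bullet> y = 1"
    and unique: "\<And>z. z \<in> dual_polytope (Gamma_polytope P) \<Longrightarrow> p \<bullet> z = 1 \<Longrightarrow> z = y"
  shows "p = append_coord 0 (- 1)"
proof -
  have P0: "0 \<in> P" using P(3) interior_subset by blast
  note mem_dual = mem_dual_Gamma[OF P0]
  obtain x t where xt: "p = append_coord x t" by (rule append_coord_cases)
  have t: "- 1 \<le> t" "t \<le> 1" and x: "x \<in> (\<lambda>y. (1 - max t 0) *\<^sub>R y) ` P"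
    using p(1) unfolding xt mem_Gamma_polytope[OF P(1) P0] by auto
  have int: "x \<in> integer_points" "t \<in> \<int>"
    using p(2) by (auto simp: xt append_coord_integer_points)
  obtain i where "t = of_int i" using int(2) by (auto elim: Ints_cases)
  then have "t = - 1 \<or> t = 0 \<or> t = 1" using t by auto
  then consider "t = - 1" | "t = 0" | "t = 1" by blast
  then show ?thesis
  proof cases
    \<comment> \<open>A base point over the boundary of \<open>P\<close> also lies on a side facet,
      so both \<open>append_coord z 0\<close> and the normal of the base attain 1.\<close>
    case 1
    have "x \<in> interior P"
    proof (rule ccontr)
      assume "x \<notin> interior P"
      then obtain z where z: "z \<in> dual_polytope P" "x \<bullet> z = 1"
        using boundary_point_dual[OF P(1,3)] x 1 by auto
      then have "append_coord z 0 \<in> dual_polytope (Gamma_polytope P)"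
        unfolding mem_dual by (simp add: dual_polytope_def)
      then have "append_coord z 0 = y"
        using z(2) by (intro unique) (simp_all add: xt inner_append_coord)
      moreover have "append_coord 0 (- 1) = y"
        using bottom_point(2)[OF P(1,3)] 1 by (intro unique) (simp_all add: xt inner_append_coord)
      ultimately show False by auto
    qed
    then show ?thesis using int(1) P(4) 1 xt by auto
  next
    \<comment> \<open>At height 0 the last coordinate of a dual vector does not enter the pairing,
      so it can be varied.\<close>
    case 2
    obtain z s where zs: "y = append_coord z s" by (rule append_coord_cases)
    have "x \<bullet> z = 1" using y(2) 2 by (simp add: xt zs inner_append_coord)
    moreover have "z \<in> dual_polytope P" using y(1) by (simp add: zs mem_dual)
    then have "append_coord z r \<in> dual_polytope (Gamma_polytope P)" if "r \<in> {0, 1}" for r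
      using that unfolding mem_dual by (auto simp: dual_polytope_def)
    ultimately have "append_coord z r = y" if "r \<in> {0, 1}" for r
      using that 2 by (intro unique) (simp_all add: xt inner_append_coord)
    from this[of 0] this[of 1] show ?thesis by auto
  next
    \<comment> \<open>At the apex every \<open>append_coord z 1\<close> with \<open>z\<close> in the
      dual of \<open>P\<close> attains 1, and this dual is a neighbourhood of 0.\<close>
    case 3
    then have "x = 0" using x by auto
    have "append_coord z 1 \<in> dual_polytope (Gamma_polytope P)" if "z \<in> dual_polytope P" for z
      using that unfolding mem_dual by (force simp: dual_polytope_def)
    then have "append_coord z 1 = y" if "z \<in> dual_polytope P" for z
      using that 3 by (intro unique) (simp_all add: xt \<open>x = 0\<close> inner_append_coord)
    then have "append_coord z 1 = append_coord 0 1" if "z \<in> dual_polytope P" for z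
      using that zero_in_dual_polytope by metis
    then have "z = 0" if "z \<in> dual_polytope P" for z
      using that by auto
    then have "z \<bullet> axis undefined 1 \<le> 0" if "z \<in> dual_polytope P" for z
      using that by (metis inner_zero_left order_refl)
    then have "axis undefined 1 = (0 :: real^'n)"
      by (rule nonpos_on_neighbourhood_imp_zero[OF zero_in_interior_dual[OF P(2)]])
    then show ?thesis by (simp add: axis_eq_0_iff)
  qed
qed

text \<open>By uniqueness of the bottom point, \<open>T\<close> fixes
  \<open>append_coord 0 (- 1)\<close> both as a point and, acting from the left, as a dual vector.
  Hence it is block diagonal with corner 1 and matches the slices at height 0.\<close>

lemma Gamma_linear_equivalence:
  fixes P Q :: "(real^'n) set"
  assumes P: "convex P" "0 \<in> interior P"
    and Q: "convex Q" "bounded Q" "0 \<in> interior Q" "interior Q \<inter> integer_points = {0}"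
    and T: "integer_matrix T" "integer_matrix T'" "T ** T' = mat 1"
    and eq: "Gamma_polytope Q = (\<lambda>v. v v* T) ` Gamma_polytope P"
  shows "\<exists>U V. integer_matrix U \<and> integer_matrix V \<and> U ** V = mat 1 \<and> Q = (\<lambda>v. v v* U) ` P"
proof -
  let ?e = "append_coord (0::real^'n) (- 1)"
  have T'T: "T' ** T = mat 1" using T(3) matrix_left_right_inverse by blast
  have cancel: "T *v (T' *v y) = y" "T' *v (T *v y) = y" "v v* T v* T' = v" for y v
    using T(3) T'T by (simp_all add: matrix_vector_mul_assoc vector_matrix_mul_assoc)
  have dual: "y \<in> dual_polytope (Gamma_polytope Q) \<longleftrightarrow> T *v y \<in> dual_polytope (Gamma_polytope P)" for y
    unfolding eq dual_polytope_def by (simp add: dot_lmul_matrix)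
  have sol: "(?e v* T) \<bullet> y = ?e \<bullet> (T *v y)" for y
    by (rule dot_lmul_matrix)
  have ee: "?e \<bullet> ?e = 1" by (simp add: inner_append_coord)
  have e1: "?e v* T = ?e"
  proof (rule bottom_point_unique[OF Q])
    show "?e v* T \<in> Gamma_polytope Q"
      unfolding eq using bottom_point(1)[OF P] by blast
    show "?e v* T \<in> integer_points"
      using T(1) by (auto simp: integer_points_def integer_matrix_def vector_matrix_mult_def sum_option)
    show "T' *v ?e \<in> dual_polytope (Gamma_polytope Q)"
      using bottom_point(2)[OF P] by (simp add: dual cancel)
    show "(?e v* T) \<bullet> (T' *v ?e) = 1"
      by (simp add: sol cancel ee)
    fix z assume "z \<in> dual_polytope (Gamma_polytope Q)" "(?e v* T) \<bullet> z = 1"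
    then have "T *v z = ?e" using bottom_point(3)[OF P] by (simp add: dual sol)
    then show "z = T' *v ?e" using cancel(2)[of z] by simp
  qed
  \<comment> \<open>Since \<open>?e v* T = ?e\<close>, the dual vector \<open>T' *v ?e\<close>
    attains 1 at the bottom point and must be the normal of the base.\<close>
  have "T' *v ?e = ?e"
    using bottom_point(3)[OF Q(1,3), of "T' *v ?e"] bottom_point(2)[OF P] e1 sol[of "T' *v ?e"]
    by (simp add: dual cancel ee)
  then have e2: "T *v ?e = ?e" using cancel(1)[of ?e] by simp
  have e3: "?e v* T' = ?e" using cancel(3)[of ?e] e1 by simp
  have neg: "append_coord 0 1 = (- 1) *\<^sub>R ?e" by (simp add: append_coord_scale)
  define U where "U = (\<chi> i j. T $ Some i $ Some j)"
  define V where "V = (\<chi> i j. T' $ Some i $ Some j)"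
  have TU: "T = block_matrix U 1"
    unfolding U_def using e1 e2 by (intro fixes_last_imp_block)
      (simp_all only: neg matrix_vector_mult_scaleR scaleR_vector_matrix_assoc)
  have TV: "T' = block_matrix V 1"
    unfolding V_def using e3 \<open>T' *v ?e = ?e\<close> by (intro fixes_last_imp_block)
      (simp_all only: neg matrix_vector_mult_scaleR scaleR_vector_matrix_assoc)
  have UV: "integer_matrix U" "integer_matrix V" "U ** V = mat 1"
    using T by (simp_all add: TU TV integer_block_matrix block_matrix_mult
        block_matrix_eq_iff flip: block_matrix_mat_1)
  have P0: "0 \<in> P" and Q0: "0 \<in> Q" using P(2) Q(3) interior_subset by blast+
  have slice_P: "append_coord x 0 \<in> Gamma_polytope P \<longleftrightarrow> x \<in> P" for x
    by (simp add: mem_Gamma_polytope[OF P(1) P0])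
  have slice_Q: "append_coord x 0 \<in> Gamma_polytope Q \<longleftrightarrow> x \<in> Q" for x
    by (simp add: mem_Gamma_polytope[OF Q(1) Q0])
  have "Q = (\<lambda>v. v v* U) ` P"
  proof (intro equalityI subsetI)
    fix q assume "q \<in> Q"
    then obtain z where z: "z \<in> Gamma_polytope P" "append_coord q 0 = z v* T"
      using slice_Q[of q] eq by auto
    obtain x t where xt: "z = append_coord x t" by (rule append_coord_cases)
    have "q = x v* U" "t = 0" using z(2) by (simp_all add: xt TU append_coord_block)
    then show "q \<in> (\<lambda>v. v v* U) ` P" using z(1) slice_P xt by auto
  next
    fix q assume "q \<in> (\<lambda>v. v v* U) ` P"
    then obtain x where x: "x \<in> P" "q = x v* U" by blast
    then have "append_coord q 0 = append_coord x 0 v* T"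
      by (simp add: TU append_coord_block)
    then have "append_coord q 0 \<in> Gamma_polytope Q" using x(1) slice_P eq by auto
    then show "q \<in> Q" using slice_Q by blast
  qed
  then show ?thesis using UV by blast
qed

section \<open>Absence of translations, and the two equivalences for reflexive polytopes\<close>

text \<open>The linear part preserves interiors and fixes 0, so \<open>w\<close> is an interior
  integer point of the dual, and the only such point is 0.\<close>

lemma unimodular_image_translation_zero:
  fixes P :: "(real^'n) set"
  assumes P: "P = convex hull W" "W \<subseteq> integer_points" "0 \<in> interior P"
    and U: "U ** V = mat 1" and w: "w \<in> integer_points"
    and eq: "dual_polytope P = (\<lambda>v. v v* U + w) ` P"
  shows "w = 0"
proof -
  have inv: "v v* U v* V = v" for v using U by (simp add: vector_matrix_mul_assoc)
  have "linear (\<lambda>v. v v* U)"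
    by (intro linearI) (simp_all add: vector_matrix_left_distrib scaleR_vector_matrix_assoc)
  moreover have "inj (\<lambda>v. v v* U)" using inv by (metis injI)
  ultimately have "interior ((\<lambda>v. v v* U) ` P) = (\<lambda>v. v v* U) ` interior P"
    by (rule interior_injective_linear_image)
  then have "0 \<in> interior ((\<lambda>v. v v* U) ` P)" using P(3) by (auto intro: image_eqI[of _ _ 0])
  then have "w \<in> interior ((+) w ` (\<lambda>v. v v* U) ` P)"
    unfolding interior_translation by (auto intro: image_eqI[of _ _ 0])
  then have "w \<in> interior (dual_polytope P)"
    unfolding eq by (simp add: image_image add.commute)
  then show ?thesis
    using interior_dual_integer_points[OF P(2), of w] P w by simp
qed

theorem mainTheorem2:
  fixes P :: "(real^'n) set"
  assumes "reflexive_polytope P"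
  shows "(unimodularly_equivalent P (dual_polytope P) \<longleftrightarrow>
            unimodularly_equivalent (Gamma_polytope P) (dual_polytope (Gamma_polytope P))) \<and>
         (delta_vector P = delta_vector (dual_polytope P) \<longleftrightarrow>
            delta_vector (Gamma_polytope P) = delta_vector (dual_polytope (Gamma_polytope P)))"
proof -
  let ?Q = "dual_polytope P"
  obtain W where W: "finite W" "W \<subseteq> integer_points" "P = convex hull W"
    using assms integral_polytope_eq_hull unfolding reflexive_polytope_def by metis
  obtain W' where W': "finite W'" "W' \<subseteq> integer_points" "?Q = convex hull W'"
    using assms integral_polytope_eq_hull unfolding reflexive_polytope_def by metis
  have int_P: "0 \<in> interior P"
    using assms unfolding reflexive_polytope_def by blast
  have P: "convex P" "bounded P" and Q: "convex ?Q" "bounded ?Q"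
    using W W' by (simp_all add: bounded_convex_hull finite_imp_bounded)
  have int_Q: "0 \<in> interior ?Q"
    by (rule zero_in_interior_dual[OF P(2)])
  have "interior ?Q \<inter> integer_points \<subseteq> {0}"
    using interior_dual_integer_points[OF W(2)] int_P W(3) by auto
  then have Q_int: "interior ?Q \<inter> integer_points = {0}"
    using int_Q zero_in_integer_points by auto
  have P0: "0 \<in> P" and Q0: "0 \<in> ?Q" using int_P int_Q interior_subset by blast+
  obtain G where G: "finite G" "G \<subseteq> integer_points" "Gamma_polytope P = convex hull G"
    using Gamma_polytope_eq_hull[OF W(1,2)] W(3) by metis
  obtain G' where G': "finite G'" "G' \<subseteq> integer_points" "Gamma_polytope ?Q = convex hull G'"
    using Gamma_polytope_eq_hull[OF W'(1,2)] W'(3) by metis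
  have int_G: "0 \<in> interior (Gamma_polytope P)" and int_G': "0 \<in> interior (Gamma_polytope ?Q)"
    using zero_in_interior_Gamma P(1) int_P Q(1) int_Q by blast+
  have dual_Gamma: "dual_polytope (Gamma_polytope P) = flip_last ` Gamma_polytope ?Q"
    by (rule dual_Gamma_flip[OF int_P])
  \<comment> \<open>As a matrix the reflection is its own integer inverse, so it can be absorbed
    into unimodular maps.\<close>
  let ?F = "block_matrix (mat 1) (- 1) :: real^('n option)^('n option)"
  have flip: "flip_last v = v v* ?F" for v :: "real^('n option)"
  proof -
    obtain x t where "v = append_coord x t" by (rule append_coord_cases)
    then show ?thesis by (simp add: append_coord_block)
  qed
  have "integer_matrix (mat 1 :: real^'n^'n)"
    by (simp add: integer_matrix_def mat_def)
  then have FF: "?F ** ?F = mat 1" "integer_matrix ?F"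
    by (simp_all add: block_matrix_mult block_matrix_mat_1 integer_block_matrix)

  have "unimodularly_equivalent (Gamma_polytope P) (dual_polytope (Gamma_polytope P))"
    if equiv: "unimodularly_equivalent P ?Q"
  proof -
    obtain U V w where U: "integer_matrix U" "integer_matrix V" "U ** V = mat 1"
      and w: "w \<in> integer_points" and eq: "?Q = (\<lambda>v. v v* U + w) ` P"
      using equiv unfolding unimodularly_equivalent_altdef by blast
    have "w = 0"
      by (rule unimodular_image_translation_zero[OF W(3,2) int_P U(3) w eq])
    then have eq: "?Q = (\<lambda>v. v v* U) ` P" using eq by simp
    have VU: "V ** U = mat 1" using U(3) matrix_left_right_inverse by blast
    have inv: "v v* U v* V = v" for v
      using U(3) by (simp add: vector_matrix_mul_assoc)
    \<comment> \<open>The block matrix keeps heights, and \<open>U\<close> commutes with the scaling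
      of each slice.\<close>
    have "append_coord x t v* block_matrix U 1 \<in> Gamma_polytope ?Q \<longleftrightarrow> append_coord x t \<in> Gamma_polytope P" for x t
    proof -
      have "x v* U \<in> (\<lambda>y. (1 - max t 0) *\<^sub>R y) ` ?Q \<longleftrightarrow>
          x \<in> (\<lambda>y. (1 - max t 0) *\<^sub>R y) ` P"
        unfolding eq image_image scaleR_vector_matrix_assoc[symmetric]
        using inv by (auto simp: image_iff) metis
      then show ?thesis
        unfolding append_coord_block mult_1_right mem_Gamma_polytope[OF P(1) P0]
          mem_Gamma_polytope[OF Q(1) Q0] by blast
    qed
    then have mem: "v v* block_matrix U 1 \<in> Gamma_polytope ?Q \<longleftrightarrow> v \<in> Gamma_polytope P" for v
      by (metis append_coord_cases)
    have "Gamma_polytope ?Q = (\<lambda>v. v v* block_matrix U 1) ` Gamma_polytope P"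
    proof (intro equalityI subsetI)
      fix v assume "v \<in> Gamma_polytope ?Q"
      moreover have "v = (v v* block_matrix V 1) v* block_matrix U 1"
        using VU by (simp add: vector_matrix_mul_assoc block_matrix_mult block_matrix_mat_1)
      ultimately show "v \<in> (\<lambda>v. v v* block_matrix U 1) ` Gamma_polytope P"
        using mem[of "v v* block_matrix V 1"] by (metis imageI)
    qed (use mem in auto)
    \<comment> \<open>Composition with the reflection changes the corner entry from 1 to -1.\<close>
    then have "dual_polytope (Gamma_polytope P) = (\<lambda>v. v v* block_matrix U (- 1) + 0) ` Gamma_polytope P"
      unfolding dual_Gamma flip
      by (simp add: image_image vector_matrix_mul_assoc block_matrix_mult)
    moreover have "block_matrix U (- 1) ** block_matrix V (- 1) = mat 1"
      using U(3) by (simp add: block_matrix_mult block_matrix_mat_1)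
    moreover have "integer_matrix (block_matrix U (- 1))" "integer_matrix (block_matrix V (- 1))"
      using U by (simp_all add: integer_block_matrix)
    ultimately show ?thesis
      unfolding unimodularly_equivalent_altdef using zero_in_integer_points by blast
  qed
  moreover have "unimodularly_equivalent P ?Q"
    if equiv: "unimodularly_equivalent (Gamma_polytope P) (dual_polytope (Gamma_polytope P))"
  proof -
    obtain M N w where M: "integer_matrix M" "integer_matrix N" "M ** N = mat 1"
      and w: "w \<in> integer_points"
      and eq: "dual_polytope (Gamma_polytope P) = (\<lambda>v. v v* M + w) ` Gamma_polytope P"
      using equiv unfolding unimodularly_equivalent_altdef by blast
    have "w = 0"
      by (rule unimodular_image_translation_zero[OF G(3,2) int_G M(3) w eq])
    then have eq: "dual_polytope (Gamma_polytope P) = (\<lambda>v. v v* M) ` Gamma_polytope P"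
      using eq by simp
    \<comment> \<open>Undoing the reflection gives a linear equivalence between the
      \<open>\<Gamma>\<close>-polytopes of \<open>P\<close> and of its dual.\<close>
    have "Gamma_polytope ?Q = flip_last ` dual_polytope (Gamma_polytope P)"
      unfolding dual_Gamma by (simp add: image_image)
    also have "\<dots> = (\<lambda>v. v v* (M ** ?F)) ` Gamma_polytope P"
      unfolding eq flip by (simp add: image_image vector_matrix_mul_assoc)
    finally have eq': "Gamma_polytope ?Q = (\<lambda>v. v v* (M ** ?F)) ` Gamma_polytope P" .
    have "(M ** ?F) ** (?F ** N) = M ** (?F ** ?F) ** N"
      by (simp add: matrix_mul_assoc)
    then have inv: "(M ** ?F) ** (?F ** N) = mat 1"
      using FF(1) M(3) by simp
    have int: "integer_matrix (M ** ?F)" "integer_matrix (?F ** N)"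
      using M FF(2) by (simp_all add: integer_matrix_mult)
    obtain U V where U: "integer_matrix U" "integer_matrix V" "U ** V = mat 1" "?Q = (\<lambda>v. v v* U) ` P"
      using Gamma_linear_equivalence[OF P(1) int_P Q int_Q Q_int int inv eq'] by blast
    then have "?Q = (\<lambda>v. v v* U + 0) ` P" by simp
    then show ?thesis
      unfolding unimodularly_equivalent_altdef using zero_in_integer_points U(1-3) by blast
  qed
  \<comment> \<open>All vectors exist, so equality of vectors becomes equality of Ehrhart series,
    which the reflection does not change.\<close>
  moreover have "delta_vector P = delta_vector ?Q \<longleftrightarrow> Ehrhart_series P = Ehrhart_series ?Q"
    using delta_vector_exists[OF W(1,2)] delta_vector_exists[OF W'(1,2)] int_P int_Q W(3) W'(3)
    by (intro delta_vector_eq_iff) auto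
  moreover have "delta_vector (Gamma_polytope P) = delta_vector (Gamma_polytope ?Q) \<longleftrightarrow>
      Ehrhart_series (Gamma_polytope P) = Ehrhart_series (Gamma_polytope ?Q)"
    using delta_vector_exists[OF G(1,2)] delta_vector_exists[OF G'(1,2)] int_G int_G' G(3) G'(3)
    by (intro delta_vector_eq_iff) auto
  moreover have "delta_vector (dual_polytope (Gamma_polytope P)) = delta_vector (Gamma_polytope ?Q)"
    unfolding dual_Gamma delta_vector_def is_delta_vector_def Ehrhart_series_flip ..
  ultimately show ?thesis
    using Ehrhart_series_Gamma_eq_iff[OF P P0 Q Q0] by auto
qed

end
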